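(* Let $\Gamma$ be a (possibly infinite) simplicial graph with vertex set $V\Gamma$ and suppose that there is a finite subset $U \subseteq V\Gamma$ which is coneless, i.e. $\bigcap_{u \in U}\operatorname{star}(u) = \emptyset$. Let $\mathcal{G} = \{G_v \mid v \in V\Gamma\}$ be a family of non-trivial groups and let $G = \Gamma\mathcal{G}$ be the graph product of $\mathcal{G}$ with respect to $\Gamma$. Then every pointwise inner endomorphism of $G$ is an inner automorphism of $G$. In particular, the group $G = \Gamma\mathcal{G}$ has Grossman's property (A).
   Context: Graphs are simplicial: $V\Gamma$ is a set and $E\Gamma \subseteq \binom{V\Gamma}{2}$. The graph product $\Gamma\mathcal{G}$ of a family of groups $\mathcal{G} = \{G_v \mid v\in V\Gamma\}$ is the quotient of the free product $\ast_{v \in V\Gamma} G_v$ by the relations $g_u g_v = g_v g_u$ for all $g_u \in G_u$, $g_v \in G_v$ whenever $\{u,v\}\in E\Gamma$. For $u \in V\Gamma$, $\operatorname{star}(u) = \{v \in V\Gamma \mid \{u,v\}\in E\Gamma\}\cup\{u\}$. A map $\phi\colon G \to G$ is pointwise inner if $\phi(g)$ is conjugate to $g$ in $G$ for every $g \in G$. A group $G$ has Grossman's property (A) if every pointwise inner automorphism of $G$ is inner. *)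

theory Defs
  imports "HOL-Algebra.Algebra" "HOL-Library.Ramsey"
begin

section \<open>Simplicial graphs\<close>

definition simplicial_graph :: "'v set \<Rightarrow> 'v set set \<Rightarrow> bool" where
  "simplicial_graph V E \<longleftrightarrow> E \<subseteq> nsets V 2"

definition star :: "'v set \<Rightarrow> 'v set set \<Rightarrow> 'v \<Rightarrow> 'v set" where
  "star V E u = {v \<in> V. {u, v} \<in> E} \<union> {u}"

text \<open>The intersection is taken inside \<open>V\<close>. This matters only for \<open>U = {}\<close>, where the empty
  intersection is \<open>V\<close> rather than the universe of the type.\<close>

definition coneless :: "'v set \<Rightarrow> 'v set set \<Rightarrow> 'v set \<Rightarrow> bool" where
  "coneless V E U \<longleftrightarrow> V \<inter> (\<Inter>u\<in>U. star V E u) = {}"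


section \<open>Free products\<close>

definition syllable_words :: "'v set \<Rightarrow> ('v \<Rightarrow> ('a, 'b) monoid_scheme) \<Rightarrow> ('v \<times> 'a) list set" where
  "syllable_words V G = lists (SIGMA v:V. carrier (G v))"

text \<open>The free product consists of the words in the disjoint union of the groups, modulo the
  congruence generated by deleting an identity syllable and by multiplying two adjacent syllables
  that lie in the same group.\<close>

inductive_set free_product_rel ::
    "'v set \<Rightarrow> ('v \<Rightarrow> ('a, 'b) monoid_scheme) \<Rightarrow> (('v \<times> 'a) list \<times> ('v \<times> 'a) list) set"
  for V G where
    refl: "w \<in> syllable_words V G \<Longrightarrow> (w, w) \<in> free_product_rel V G"
  | sym: "(w, w') \<in> free_product_rel V G \<Longrightarrow> (w', w) \<in> free_product_rel V G"
  | trans: "\<lbrakk>(w, w') \<in> free_product_rel V G; (w', w'') \<in> free_product_rel V G\<rbrakk>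
      \<Longrightarrow> (w, w'') \<in> free_product_rel V G"
  | unit: "\<lbrakk>xs \<in> syllable_words V G; ys \<in> syllable_words V G; v \<in> V\<rbrakk>
      \<Longrightarrow> (xs @ [(v, \<one>\<^bsub>G v\<^esub>)] @ ys, xs @ ys) \<in> free_product_rel V G"
  | mult: "\<lbrakk>xs \<in> syllable_words V G; ys \<in> syllable_words V G; v \<in> V;
        g \<in> carrier (G v); h \<in> carrier (G v)\<rbrakk>
      \<Longrightarrow> (xs @ [(v, g), (v, h)] @ ys, xs @ [(v, g \<otimes>\<^bsub>G v\<^esub> h)] @ ys) \<in> free_product_rel V G"

definition free_product ::
    "'v set \<Rightarrow> ('v \<Rightarrow> ('a, 'b) monoid_scheme) \<Rightarrow> ('v \<times> 'a) list set monoid" where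
  "free_product V G =
    \<lparr> carrier = syllable_words V G // free_product_rel V G,
      monoid.mult = (\<lambda>A B. \<Union>a\<in>A. \<Union>b\<in>B. free_product_rel V G `` {a @ b}),
      one = free_product_rel V G `` {[]} \<rparr>"

definition free_product_incl ::
    "'v set \<Rightarrow> ('v \<Rightarrow> ('a, 'b) monoid_scheme) \<Rightarrow> 'v \<Rightarrow> 'a \<Rightarrow> ('v \<times> 'a) list set" where
  "free_product_incl V G v g = free_product_rel V G `` {[(v, g)]}"


section \<open>Graph products\<close>

definition normal_closure :: "('a, 'b) monoid_scheme \<Rightarrow> 'a set \<Rightarrow> 'a set" where
  "normal_closure G S =
    generate G {x \<otimes>\<^bsub>G\<^esub> s \<otimes>\<^bsub>G\<^esub> inv\<^bsub>G\<^esub> x | x s. x \<in> carrier G \<and> s \<in> S}"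

definition graph_product_relators ::
    "'v set \<Rightarrow> 'v set set \<Rightarrow> ('v \<Rightarrow> ('a, 'b) monoid_scheme) \<Rightarrow> ('v \<times> 'a) list set set" where
  "graph_product_relators V E G =
    {free_product_incl V G u g \<otimes>\<^bsub>free_product V G\<^esub> free_product_incl V G v h
       \<otimes>\<^bsub>free_product V G\<^esub> inv\<^bsub>free_product V G\<^esub> (free_product_incl V G u g)
       \<otimes>\<^bsub>free_product V G\<^esub> inv\<^bsub>free_product V G\<^esub> (free_product_incl V G v h)
     | u v g h. u \<in> V \<and> v \<in> V \<and> {u, v} \<in> E \<and> g \<in> carrier (G u) \<and> h \<in> carrier (G v)}"

definition graph_product ::
    "'v set \<Rightarrow> 'v set set \<Rightarrow> ('v \<Rightarrow> ('a, 'b) monoid_scheme) \<Rightarrow> ('v \<times> 'a) list set set monoid" where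
  "graph_product V E G =
    free_product V G Mod normal_closure (free_product V G) (graph_product_relators V E G)"


section \<open>Pointwise inner maps and Grossman's property (A)\<close>

definition pointwise_inner :: "('a, 'b) monoid_scheme \<Rightarrow> ('a \<Rightarrow> 'a) \<Rightarrow> bool" where
  "pointwise_inner G \<phi> \<longleftrightarrow>
    (\<forall>g\<in>carrier G. \<exists>x\<in>carrier G. \<phi> g = x \<otimes>\<^bsub>G\<^esub> g \<otimes>\<^bsub>G\<^esub> inv\<^bsub>G\<^esub> x)"

definition inner_automorphism :: "('a, 'b) monoid_scheme \<Rightarrow> ('a \<Rightarrow> 'a) \<Rightarrow> bool" where
  "inner_automorphism G \<phi> \<longleftrightarrow>
    (\<exists>x\<in>carrier G. \<forall>g\<in>carrier G. \<phi> g = x \<otimes>\<^bsub>G\<^esub> g \<otimes>\<^bsub>G\<^esub> inv\<^bsub>G\<^esub> x)"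

definition grossman_property_A :: "('a, 'b) monoid_scheme \<Rightarrow> bool" where
  "grossman_property_A G \<longleftrightarrow> (\<forall>\<phi>\<in>iso G G. pointwise_inner G \<phi> \<longrightarrow> inner_automorphism G \<phi>)"


section \<open>Well-definedness\<close>

lemma free_product_rel_words:
  assumes "\<forall>v\<in>V. group (G v)" and "(w, w') \<in> free_product_rel V G"
  shows "w \<in> syllable_words V G \<and> w' \<in> syllable_words V G"
  using assms(2)
  by induction
    (use assms(1) in \<open>auto simp: syllable_words_def group.is_monoid monoid.m_closed monoid.one_closed\<close>)

lemma equiv_free_product_rel:
  assumes "\<forall>v\<in>V. group (G v)"
  shows "equiv (syllable_words V G) (free_product_rel V G)"
  by (rule equivI)
    (use free_product_rel_words[OF assms] in
      \<open>auto simp: refl_on_def sym_def trans_def intro: free_product_rel.intros\<close>)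

lemma free_product_rel_append:
  assumes "\<forall>v\<in>V. group (G v)" and "(w, w') \<in> free_product_rel V G"
    and "a \<in> syllable_words V G" "b \<in> syllable_words V G"
  shows "(a @ w @ b, a @ w' @ b) \<in> free_product_rel V G"
  using assms(2)
proof induction
  case (refl w)
  then show ?case
    using assms(3,4) by (auto simp: syllable_words_def intro!: free_product_rel.refl)
next
  case (sym w w')
  then show ?case by (auto intro: free_product_rel.sym)
next
  case (trans w w' w'')
  then show ?case by (blast intro: free_product_rel.trans)
next
  case (unit xs ys v)
  then show ?case
    using free_product_rel.unit[of "a @ xs" V G "ys @ b" v] assms(3,4)
    by (auto simp: syllable_words_def)
next
  case (mult xs ys v g h)
  then show ?case
    using free_product_rel.mult[of "a @ xs" V G "ys @ b" v g h] assms(3,4)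
    by (auto simp: syllable_words_def)
qed

lemma free_product_mult_class:
  assumes grp: "\<forall>v\<in>V. group (G v)"
    and "a \<in> syllable_words V G" "b \<in> syllable_words V G"
  shows "(free_product_rel V G `` {a}) \<otimes>\<^bsub>free_product V G\<^esub> (free_product_rel V G `` {b})
    = free_product_rel V G `` {a @ b}"
proof -
  have "congruent2 (free_product_rel V G) (free_product_rel V G)
      (\<lambda>a b. free_product_rel V G `` {a @ b})"
  proof (rule congruent2I')
    fix a a' b b'
    assume *: "(a, a') \<in> free_product_rel V G" "(b, b') \<in> free_product_rel V G"
    note words = *[THEN free_product_rel_words[OF grp]]
    have nil: "[] \<in> syllable_words V G" by (simp add: syllable_words_def)
    have "(a @ b, a' @ b) \<in> free_product_rel V G"
      using free_product_rel_append[OF grp *(1) nil] words by force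
    moreover have "(a' @ b, a' @ b') \<in> free_product_rel V G"
      using free_product_rel_append[OF grp *(2) _ nil, of a'] words by force
    ultimately have "(a @ b, a' @ b') \<in> free_product_rel V G"
      by (rule free_product_rel.trans)
    then show "free_product_rel V G `` {a @ b} = free_product_rel V G `` {a' @ b'}"
      by (rule equiv_class_eq[OF equiv_free_product_rel[OF grp]])
  qed
  from UN_equiv_class2[OF equiv_free_product_rel[OF grp] equiv_free_product_rel[OF grp] this assms(2,3)]
  show ?thesis by (simp add: free_product_def)
qed

lemma free_product_carrierI:
  "w \<in> syllable_words V G \<Longrightarrow> free_product_rel V G `` {w} \<in> carrier (free_product V G)"
  by (simp add: free_product_def quotientI)

lemma free_product_carrierE:
  assumes "x \<in> carrier (free_product V G)"
  obtains w where "w \<in> syllable_words V G" "x = free_product_rel V G `` {w}"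
  using assms by (auto simp: free_product_def elim: quotientE)

lemma free_product_word_inv:
  assumes grp: "\<forall>v\<in>V. group (G v)" and "w \<in> syllable_words V G"
  shows "\<exists>w'\<in>syllable_words V G. (w' @ w, []) \<in> free_product_rel V G"
  using assms(2)
proof (induction w)
  case Nil
  then show ?case by (auto simp: syllable_words_def intro!: free_product_rel.refl bexI[of _ "[]"])
next
  case (Cons p w)
  obtain v g where p: "p = (v, g)" by (cases p)
  have v: "v \<in> V" "g \<in> carrier (G v)" and w: "w \<in> syllable_words V G"
    using Cons.prems p by (auto simp: syllable_words_def)
  obtain w' where w': "w' \<in> syllable_words V G" "(w' @ w, []) \<in> free_product_rel V G"
    using Cons.IH w by blast
  interpret Gv: group "G v" by (rule bspec[OF grp v(1)])
  let ?i = "inv\<^bsub>G v\<^esub> g"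
  have "(w' @ [(v, ?i), (v, g)] @ w, w' @ [(v, \<one>\<^bsub>G v\<^esub>)] @ w) \<in> free_product_rel V G"
    using free_product_rel.mult[OF w'(1) w v(1) Gv.inv_closed[OF v(2)] v(2)] v by simp
  also have "(w' @ [(v, \<one>\<^bsub>G v\<^esub>)] @ w, w' @ w) \<in> free_product_rel V G"
    by (rule free_product_rel.unit[OF w'(1) w v(1)])
  finally (free_product_rel.trans) have "((w' @ [(v, ?i)]) @ p # w, []) \<in> free_product_rel V G"
    using w'(2) p by (auto intro: free_product_rel.trans)
  moreover have "w' @ [(v, ?i)] \<in> syllable_words V G"
    using w'(1) v by (simp add: syllable_words_def)
  ultimately show ?case by blast
qed

lemma group_free_product:
  assumes grp: "\<forall>v\<in>V. group (G v)"
  shows "group (free_product V G)"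
proof -
  note mult = free_product_mult_class[OF grp]
  have app: "a @ b \<in> syllable_words V G"
    if "a \<in> syllable_words V G" "b \<in> syllable_words V G" for a b
    using that by (simp add: syllable_words_def)
  have nil: "[] \<in> syllable_words V G" by (simp add: syllable_words_def)
  have one: "\<one>\<^bsub>free_product V G\<^esub> = free_product_rel V G `` {[]}"
    by (simp add: free_product_def)
  show ?thesis
  proof (rule groupI)
    show "\<one>\<^bsub>free_product V G\<^esub> \<in> carrier (free_product V G)"
      by (simp add: one free_product_carrierI nil)
  next
    fix x y assume "x \<in> carrier (free_product V G)" "y \<in> carrier (free_product V G)"
    then show "x \<otimes>\<^bsub>free_product V G\<^esub> y \<in> carrier (free_product V G)"
      by (elim free_product_carrierE) (simp add: mult app free_product_carrierI)
  next
    fix x y z assume "x \<in> carrier (free_product V G)" "y \<in> carrier (free_product V G)"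
      "z \<in> carrier (free_product V G)"
    then show "x \<otimes>\<^bsub>free_product V G\<^esub> y \<otimes>\<^bsub>free_product V G\<^esub> z
        = x \<otimes>\<^bsub>free_product V G\<^esub> (y \<otimes>\<^bsub>free_product V G\<^esub> z)"
      by (elim free_product_carrierE) (simp add: mult app)
  next
    fix x assume "x \<in> carrier (free_product V G)"
    then show "\<one>\<^bsub>free_product V G\<^esub> \<otimes>\<^bsub>free_product V G\<^esub> x = x"
      by (elim free_product_carrierE) (simp add: one mult nil)
  next
    fix x assume "x \<in> carrier (free_product V G)"
    then obtain w where w: "w \<in> syllable_words V G" "x = free_product_rel V G `` {w}"
      by (rule free_product_carrierE)
    obtain w' where w': "w' \<in> syllable_words V G" "(w' @ w, []) \<in> free_product_rel V G"
      using free_product_word_inv[OF grp w(1)] by blast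
    have "(free_product_rel V G `` {w'}) \<otimes>\<^bsub>free_product V G\<^esub> x = \<one>\<^bsub>free_product V G\<^esub>"
      using equiv_class_eq[OF equiv_free_product_rel[OF grp] w'(2)] w w'(1)
      by (simp add: mult one)
    with w'(1) show "\<exists>y\<in>carrier (free_product V G).
        y \<otimes>\<^bsub>free_product V G\<^esub> x = \<one>\<^bsub>free_product V G\<^esub>"
      by (blast intro: free_product_carrierI)
  qed
qed

lemma free_product_incl_hom:
  assumes grp: "\<forall>v\<in>V. group (G v)" and v: "v \<in> V"
  shows "free_product_incl V G v \<in> hom (G v) (free_product V G)"
proof (rule homI)
  fix g assume "g \<in> carrier (G v)"
  then show "free_product_incl V G v g \<in> carrier (free_product V G)"
    using v by (simp add: free_product_incl_def free_product_carrierI syllable_words_def)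
next
  fix g h assume gh: "g \<in> carrier (G v)" "h \<in> carrier (G v)"
  have "([(v, g), (v, h)], [(v, g \<otimes>\<^bsub>G v\<^esub> h)]) \<in> free_product_rel V G"
    using free_product_rel.mult[of "[]" V G "[]" v g h] v gh by (simp add: syllable_words_def)
  then show "free_product_incl V G v (g \<otimes>\<^bsub>G v\<^esub> h)
      = free_product_incl V G v g \<otimes>\<^bsub>free_product V G\<^esub> free_product_incl V G v h"
    using v gh equiv_class_eq[OF equiv_free_product_rel[OF grp]]
    by (simp add: free_product_incl_def free_product_mult_class[OF grp] syllable_words_def)
qed

lemma (in group) normal_closure_normal:
  assumes "S \<subseteq> carrier G"
  shows "normal_closure G S \<lhd> G"
  unfolding normal_closure_def
proof (rule normal_generateI)
  show "{x \<otimes> s \<otimes> inv x |x s. x \<in> carrier G \<and> s \<in> S} \<subseteq> carrier G"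
    using assms by auto
next
  fix h g assume "h \<in> {x \<otimes> s \<otimes> inv x |x s. x \<in> carrier G \<and> s \<in> S}" and g: "g \<in> carrier G"
  then obtain x s where xs: "h = x \<otimes> s \<otimes> inv x" "x \<in> carrier G" "s \<in> S" by blast
  with assms have "s \<in> carrier G" by blast
  with xs g have "g \<otimes> h \<otimes> inv g = (g \<otimes> x) \<otimes> s \<otimes> inv (g \<otimes> x)"
    by (simp add: inv_mult_group m_assoc)
  with xs g show "g \<otimes> h \<otimes> inv g \<in> {x \<otimes> s \<otimes> inv x |x s. x \<in> carrier G \<and> s \<in> S}"
    by blast
qed

lemma graph_product_relators_carrier:
  assumes grp: "\<forall>v\<in>V. group (G v)"
  shows "graph_product_relators V E G \<subseteq> carrier (free_product V G)"
proof -
  interpret F: group "free_product V G" by (rule group_free_product[OF grp])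
  show ?thesis
    using hom_in_carrier[OF free_product_incl_hom[OF grp]]
    by (auto simp: graph_product_relators_def)
qed

lemma group_graph_product:
  assumes grp: "\<forall>v\<in>V. group (G v)"
  shows "group (graph_product V E G)"
  unfolding graph_product_def
  by (intro normal.factorgroup_is_group group.normal_closure_normal group_free_product
      graph_product_relators_carrier grp)

lemma (in group) inner_automorphism_iso:
  assumes "inner_automorphism G \<phi>"
  shows "\<phi> \<in> iso G G"
proof -
  obtain x where x: "x \<in> carrier G" "\<And>g. g \<in> carrier G \<Longrightarrow> \<phi> g = x \<otimes> g \<otimes> inv x"
    using assms by (auto simp: inner_automorphism_def)
  show ?thesis
  proof (rule isoI)
    show "\<phi> \<in> hom G G"
    proof (rule homI)
      fix g h assume gh: "g \<in> carrier G" "h \<in> carrier G"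
      have "x \<otimes> (g \<otimes> h) \<otimes> inv x = x \<otimes> g \<otimes> (inv x \<otimes> x) \<otimes> h \<otimes> inv x"
        using x(1) gh by (simp add: m_assoc)
      also have "\<dots> = (x \<otimes> g \<otimes> inv x) \<otimes> (x \<otimes> h \<otimes> inv x)"
        using x(1) gh by (simp only: m_assoc m_closed inv_closed)
      finally show "\<phi> (g \<otimes> h) = \<phi> g \<otimes> \<phi> h" using x gh by simp
    qed (use x in simp)
    show "bij_betw \<phi> (carrier G) (carrier G)"
    proof (rule bij_betwI[where g = "\<lambda>g. inv x \<otimes> g \<otimes> x"])
      fix g assume g: "g \<in> carrier G"
      have "inv x \<otimes> (x \<otimes> g \<otimes> inv x) \<otimes> x = (inv x \<otimes> x) \<otimes> g \<otimes> (inv x \<otimes> x)"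
        using x(1) g by (simp only: m_assoc m_closed inv_closed)
      then show "inv x \<otimes> \<phi> g \<otimes> x = g" using x g by simp
      have "x \<otimes> (inv x \<otimes> g \<otimes> x) \<otimes> inv x = (x \<otimes> inv x) \<otimes> g \<otimes> (x \<otimes> inv x)"
        using x(1) g by (simp only: m_assoc m_closed inv_closed)
      then show "\<phi> (inv x \<otimes> g \<otimes> x) = g" using x g by simp
    qed (use x in auto)
  qed
qed

end

theory Submission
  imports Defs
begin

text \<open>
  Let \<open>\<phi>\<close> be pointwise inner, say \<open>\<phi> g = c g c\<inverse>\<close> with \<open>c = c(g)\<close>. For \<open>g \<in> G\<^sub>u\<close> and
  \<open>h \<in> G\<^sub>v\<close> non-trivial, write \<open>c(g)\<inverse> c(h) = a z b\<close> with \<open>a \<in> G\<^bsub>star u\<^esub>\<close>, \<open>b \<in> G\<^bsub>star v\<^esub>\<close> and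
  \<open>z\<close> shortest in its double coset. Then \<open>\<phi> (g h)\<close> is conjugate to a product \<open>g' z h' z\<inverse>\<close>, whose
  powers have syllable length \<open>n (2 + 2 |z|)\<close> if \<open>z \<noteq> 1\<close>; this is too much for a conjugate of
  \<open>g h\<close>, so \<open>z = 1\<close> and the cosets \<open>c(g) G\<^bsub>star u\<^esub>\<close> and \<open>c(h) G\<^bsub>star v\<^esub>\<close> meet. Cosets of parabolic
  subgroups have the Helly property, so finitely many of these cosets have a common point, and it is
  unique once they are indexed by a coneless set of vertices. Hence all of them contain one element
  \<open>x\<close>, and after conjugation by \<open>x\<close> the map \<open>\<phi>\<close> preserves every \<open>G\<^sub>v\<close>. Given \<open>g \<in> G\<^sub>v\<close>, choose a vertex
  \<open>u \<noteq> v\<close> not adjacent to \<open>v\<close> and a non-trivial \<open>h \<in> G\<^sub>u\<close>: the elements \<open>\<phi> g \<phi> h\<close> and \<open>g h\<close> can only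
  be conjugate if \<open>\<phi> g = g\<close>.
\<close>

section \<open>Groups with syllable decompositions\<close>

text \<open>\<open>front v x\<close> stands for the syllable of \<open>v\<close> with which some reduced word for \<open>x\<close> begins, and
  for \<open>\<one>\<close> if there is no such word. The axioms on it are all that is used of the normal form theorem
  for graph products.\<close>

locale syllable_group = group P for P (structure) +
  fixes V :: "'v set" and adj :: "'v \<Rightarrow> 'v \<Rightarrow> bool" and H :: "'v \<Rightarrow> 'a set"
    and front :: "'v \<Rightarrow> 'a \<Rightarrow> 'a"
  assumes adj_sym: "adj u v \<Longrightarrow> adj v u"
    and adj_irrefl: "\<not> adj v v"
    and H_subgroup: "v \<in> V \<Longrightarrow> subgroup (H v) P"
    and H_commute: "\<lbrakk>adj u v; u \<in> V; v \<in> V; g \<in> H u; h \<in> H v\<rbrakk> \<Longrightarrow> g \<otimes> h = h \<otimes> g"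
    and H_generate: "\<lbrakk>x \<in> carrier P; Q \<one>;
          \<And>v k y. \<lbrakk>v \<in> V; k \<in> H v; y \<in> carrier P; Q y\<rbrakk> \<Longrightarrow> Q (k \<otimes> y)\<rbrakk> \<Longrightarrow> Q x"
    and front_H: "\<lbrakk>v \<in> V; x \<in> carrier P\<rbrakk> \<Longrightarrow> front v x \<in> H v"
    and front_one: "v \<in> V \<Longrightarrow> front v \<one> = \<one>"
    and front_same: "\<lbrakk>v \<in> V; k \<in> H v; x \<in> carrier P\<rbrakk> \<Longrightarrow> front v (k \<otimes> x) = k \<otimes> front v x"
    and front_adj: "\<lbrakk>adj u v; u \<in> V; v \<in> V; k \<in> H u; x \<in> carrier P\<rbrakk> \<Longrightarrow> front v (k \<otimes> x) = front v x"
    and front_nonadj: "\<lbrakk>\<not> adj u v; u \<noteq> v; u \<in> V; v \<in> V; x \<in> carrier P\<rbrakk>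
      \<Longrightarrow> front u x = \<one> \<or> front v x = \<one>"
begin

section \<open>Vertex subgroups and initial syllables\<close>

lemma inv_cancel_left [simp]: "\<lbrakk>x \<in> carrier P; y \<in> carrier P\<rbrakk> \<Longrightarrow> inv x \<otimes> (x \<otimes> y) = y"
  by (simp add: m_assoc[symmetric])

lemma inv_cancel_right [simp]: "\<lbrakk>x \<in> carrier P; y \<in> carrier P\<rbrakk> \<Longrightarrow> x \<otimes> (inv x \<otimes> y) = y"
  by (simp add: m_assoc[symmetric])

lemma H_carrier: "\<lbrakk>v \<in> V; k \<in> H v\<rbrakk> \<Longrightarrow> k \<in> carrier P"
  by (rule subgroup.mem_carrier[OF H_subgroup])

lemma H_one: "v \<in> V \<Longrightarrow> \<one> \<in> H v"
  by (simp add: H_subgroup subgroup.one_closed)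

lemma H_mult: "\<lbrakk>v \<in> V; k \<in> H v; h \<in> H v\<rbrakk> \<Longrightarrow> k \<otimes> h \<in> H v"
  by (simp add: H_subgroup subgroup.m_closed)

lemma H_inv: "\<lbrakk>v \<in> V; k \<in> H v\<rbrakk> \<Longrightarrow> inv k \<in> H v"
  by (simp add: H_subgroup subgroup.m_inv_closed)

lemma inv_neq_one: "\<lbrakk>x \<in> carrier P; x \<noteq> \<one>\<rbrakk> \<Longrightarrow> inv x \<noteq> \<one>"
  using inv_inv[of x] by auto

lemma front_carrier [simp]: "\<lbrakk>v \<in> V; x \<in> carrier P\<rbrakk> \<Longrightarrow> front v x \<in> carrier P"
  by (rule H_carrier[OF _ front_H])

lemma front_syllable: "\<lbrakk>v \<in> V; k \<in> H v\<rbrakk> \<Longrightarrow> front v k = k"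
  using front_same[of v k \<one>] by (simp add: H_carrier front_one)

lemma front_stripped: "\<lbrakk>v \<in> V; x \<in> carrier P\<rbrakk> \<Longrightarrow> front v (inv (front v x) \<otimes> x) = \<one>"
  by (simp add: H_inv front_H front_same)

lemma front_nonadj_mult:
  assumes "\<not> adj u v" "u \<noteq> v" "u \<in> V" "v \<in> V" "k \<in> H u" "x \<in> carrier P" "front u (k \<otimes> x) \<noteq> \<one>"
  shows "front v (k \<otimes> x) = \<one>"
  using front_nonadj[OF assms(1-4)] assms H_carrier by blast

text \<open>The side condition \<open>front v x = \<one>\<close> prevents \<open>k\<close> from
  merging with a later syllable, so \<open>n\<close> counts the syllables of a reduced word. The set
  \<open>S\<close> bounds the support: \<open>V\<close> yields the length function, smaller sets
  serve the parabolic subgroups.\<close>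

inductive reduced :: "'v set \<Rightarrow> nat \<Rightarrow> 'a \<Rightarrow> bool" for S where
  reduced_one: "reduced S 0 \<one>"
| reduced_mult: "\<lbrakk>reduced S n x; v \<in> S; v \<in> V; k \<in> H v; k \<noteq> \<one>; front v x = \<one>\<rbrakk>
    \<Longrightarrow> reduced S (Suc n) (k \<otimes> x)"

lemma reduced_carrier: "reduced S n x \<Longrightarrow> x \<in> carrier P"
  by (induction rule: reduced.induct) (auto simp: H_carrier)

lemma reduced_front_mult:
  assumes "v \<in> V" "k \<in> H v" "x \<in> carrier P" "front v x = \<one>"
  shows "front v (k \<otimes> x) = k"
  using assms by (simp add: front_same H_carrier)

lemma reduced_front:
  assumes "reduced S n x" "r \<in> V" "front r x \<noteq> \<one>"
  shows "r \<in> S"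
  using assms
proof (induction rule: reduced.induct)
  case reduced_one
  then show ?case by (simp add: front_one)
next
  case (reduced_mult n x v k)
  then have x: "x \<in> carrier P" by (simp add: reduced_carrier)
  have "front v (k \<otimes> x) \<noteq> \<one>"
    using reduced_mult x by (simp add: reduced_front_mult)
  then have "r = v \<or> adj v r"
    using front_nonadj_mult[of v r k x] x reduced_mult.hyps reduced_mult.prems by blast
  then show ?case
    using front_adj[of v r k x] x reduced_mult.hyps reduced_mult.prems reduced_mult.IH by fastforce
qed

text \<open>An initial syllable at \<open>r \<noteq> v\<close> can coexist with the initial syllable
  \<open>k\<close> at \<open>v\<close> only if \<open>r\<close> and \<open>v\<close> are adjacent;
  it then commutes past \<open>k\<close> and is split off the rest by induction. Both existence and
  uniqueness of the length rest on this.\<close>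

lemma reduced_strip:
  assumes "reduced S n x" "r \<in> V" "front r x \<noteq> \<one>"
  shows "\<exists>m. n = Suc m \<and> reduced S m (inv (front r x) \<otimes> x)"
  using assms
proof (induction rule: reduced.induct)
  case reduced_one
  then show ?case by (simp add: front_one)
next
  case (reduced_mult n x v k)
  then have x: "x \<in> carrier P" and k: "k \<in> carrier P"
    by (simp_all add: reduced_carrier H_carrier)
  have fv: "front v (k \<otimes> x) = k"
    using reduced_mult x by (simp add: reduced_front_mult)
  show ?case
  proof (cases "r = v")
    case True
    then show ?thesis using fv x k reduced_mult by simp
  next
    case False
    then have adj: "adj v r"
      using fv front_nonadj_mult[of v r k x] reduced_mult x by auto
    let ?h = "front r x"
    have h: "front r (k \<otimes> x) = ?h" "?h \<in> H r" "?h \<in> carrier P" "inv ?h \<in> H r"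
      using adj reduced_mult x by (auto simp: front_adj front_H H_inv)
    obtain m where m: "n = Suc m" "reduced S m (inv ?h \<otimes> x)"
      using reduced_mult h by auto
    have "front v (inv ?h \<otimes> x) = \<one>"
      using front_adj[OF adj_sym[OF adj] \<open>r \<in> V\<close> \<open>v \<in> V\<close> h(4) x] reduced_mult by simp
    then have "reduced S (Suc m) (k \<otimes> (inv ?h \<otimes> x))"
      using m reduced_mult by (auto intro: reduced.reduced_mult)
    moreover have "k \<otimes> inv ?h = inv ?h \<otimes> k"
      using H_commute[OF adj] reduced_mult h by blast
    then have "k \<otimes> (inv ?h \<otimes> x) = inv ?h \<otimes> (k \<otimes> x)"
      using k h x by (simp add: m_assoc[symmetric])
    ultimately show ?thesis using m h by auto
  qed
qed

lemma reduced_mult_syllable: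
  assumes "reduced S n x" "v \<in> V" "v \<in> S" "k \<in> H v"
  shows "\<exists>m. reduced S m (k \<otimes> x)"
proof -
  have x: "x \<in> carrier P" using assms(1) by (rule reduced_carrier)
  let ?h = "front v x"
  obtain m where m: "reduced S m (inv ?h \<otimes> x)"
    using reduced_strip[OF assms(1,2)] assms(1) x by (cases "?h = \<one>") auto
  have eq: "k \<otimes> x = (k \<otimes> ?h) \<otimes> (inv ?h \<otimes> x)"
    using x assms H_carrier by (simp add: m_assoc)
  show ?thesis
  proof (cases "k \<otimes> ?h = \<one>")
    case True
    then show ?thesis using m x assms by (auto simp: eq)
  next
    case False
    then have "reduced S (Suc m) ((k \<otimes> ?h) \<otimes> (inv ?h \<otimes> x))"
      using m assms x by (intro reduced_mult) (auto simp: H_mult front_H front_stripped)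
    then show ?thesis using eq by auto
  qed
qed

lemma reduced_exists: "x \<in> carrier P \<Longrightarrow> \<exists>n. reduced V n x"
  by (erule H_generate) (auto intro: reduced_one reduced_mult_syllable)

text \<open>Stripping the first syllable \<open>k\<close> of one decomposition from the other leaves
  two decompositions of the same shorter element.\<close>

lemma reduced_unique:
  assumes "reduced S n x" "reduced S m x"
  shows "n = m"
  using assms
proof (induction arbitrary: m rule: reduced.induct)
  case reduced_one
  then show ?case
  proof cases
    case (reduced_mult n y v k)
    then have "front v (k \<otimes> y) = k" by (simp add: reduced_front_mult reduced_carrier)
    then show ?thesis using reduced_mult front_one by metis
  qed simp
next
  case (reduced_mult n x v k)
  then have x: "x \<in> carrier P" and k: "k \<in> carrier P"
    by (simp_all add: reduced_carrier H_carrier)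
  have fv: "front v (k \<otimes> x) = k"
    using reduced_mult x by (simp add: reduced_front_mult)
  then obtain l where "m = Suc l" "reduced S l x"
    using reduced_strip[OF \<open>reduced S m (k \<otimes> x)\<close> \<open>v \<in> V\<close>] reduced_mult k x by auto
  then show ?case using reduced_mult by auto
qed

section \<open>Syllable length\<close>

definition len :: "'a \<Rightarrow> nat" where
  "len x = (THE n. reduced V n x)"

lemma len_eq: "reduced V n x \<Longrightarrow> len x = n"
  unfolding len_def using reduced_unique by blast

lemma reduced_len: "x \<in> carrier P \<Longrightarrow> reduced V (len x) x"
  using reduced_exists len_eq by metis

lemma len_one [simp]: "len \<one> = 0"
  by (simp add: len_eq reduced_one)

lemma len_mult_syllable:
  assumes "v \<in> V" "k \<in> H v" "k \<noteq> \<one>" "x \<in> carrier P" "front v x = \<one>"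
  shows "len (k \<otimes> x) = Suc (len x)"
  using assms by (intro len_eq reduced_mult reduced_len) auto

lemma len_strip:
  assumes "v \<in> V" "x \<in> carrier P" "front v x \<noteq> \<one>"
  shows "len x = Suc (len (inv (front v x) \<otimes> x))"
  using reduced_strip[OF reduced_len assms(1,3)] assms len_eq by fastforce

text \<open>Induction along a reduced decomposition. The step supplies the length and the front of
  \<open>k \<otimes> x\<close>, so that most later arguments can avoid
  \<open>reduced\<close>.\<close>

lemma len_induct [consumes 1, case_names one mult]:
  assumes "x \<in> carrier P" "Q \<one>"
    and step: "\<And>v k x. \<lbrakk>x \<in> carrier P; v \<in> V; k \<in> H v; k \<in> carrier P; k \<noteq> \<one>; front v x = \<one>;
      len (k \<otimes> x) = Suc (len x); front v (k \<otimes> x) = k; Q x\<rbrakk> \<Longrightarrow> Q (k \<otimes> x)"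
  shows "Q x"
  using reduced_len[OF assms(1)]
proof (induction rule: reduced.induct)
  case reduced_one
  show ?case by (rule assms(2))
next
  case (reduced_mult n x v k)
  then show ?case
    by (intro step) (auto simp: H_carrier len_mult_syllable reduced_front_mult reduced_carrier)
qed

lemma len_mult_le_if_front:
  assumes "v \<in> V" "k \<in> H v" "x \<in> carrier P" "front v x \<noteq> \<one>"
  shows "len (k \<otimes> x) \<le> len x"
proof -
  let ?h = "front v x"
  let ?y = "inv ?h \<otimes> x"
  have y: "?y \<in> carrier P" "front v ?y = \<one>" "len x = Suc (len ?y)"
    using assms front_stripped len_strip by auto
  have eq: "k \<otimes> x = (k \<otimes> ?h) \<otimes> ?y"
    using assms H_carrier by (simp add: m_assoc)
  have "k \<otimes> ?h \<in> H v" using assms H_mult front_H by blast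
  then show ?thesis
    using len_mult_syllable[of v "k \<otimes> ?h" ?y] y assms eq
    by (cases "k \<otimes> ?h = \<one>") auto
qed

lemma len_mult_syllable_le:
  assumes "v \<in> V" "k \<in> H v" "x \<in> carrier P"
  shows "len (k \<otimes> x) \<le> Suc (len x)"
proof (cases "front v x = \<one>")
  case True
  then show ?thesis using assms len_mult_syllable[of v k x] by (cases "k = \<one>") auto
next
  case False
  then show ?thesis using assms len_mult_le_if_front[of v k x] by simp
qed

lemma len_syllable_le: "\<lbrakk>v \<in> V; k \<in> H v\<rbrakk> \<Longrightarrow> len k \<le> 1"
  using len_mult_syllable_le[of v k \<one>] H_carrier by simp

lemma len_mult_le:
  assumes "x \<in> carrier P" "y \<in> carrier P"
  shows "len (x \<otimes> y) \<le> len x + len y"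
  using assms(1)
proof (induction rule: len_induct)
  case one
  then show ?case using assms by simp
next
  case (mult v k x)
  then show ?case
    using len_mult_syllable_le[of v k "x \<otimes> y"] assms by (simp add: m_assoc)
qed

lemma len_inv_le:
  assumes "x \<in> carrier P"
  shows "len (inv x) \<le> len x"
  using assms
proof (induction rule: len_induct)
  case (mult v k x)
  then show ?case
    using len_mult_le[of "inv x" "inv k"] len_syllable_le[of v "inv k"] H_inv
    by (simp add: inv_mult_group)
qed auto

lemma len_inv [simp]: "x \<in> carrier P \<Longrightarrow> len (inv x) = len x"
  using len_inv_le[of x] len_inv_le[of "inv x"] by simp

lemma front_exists:
  assumes "x \<in> carrier P" "x \<noteq> \<one>"
  shows "\<exists>v\<in>V. front v x \<noteq> \<one>"
  using assms
proof (induction rule: len_induct)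
  case (mult v k x)
  then show ?case by (intro bexI[of _ v]) simp_all
qed simp

section \<open>Parabolic subgroups\<close>

text \<open>The standard parabolic subgroup on \<open>S\<close>. Building elements by left
  multiplication gives the same kind of induction as for reduced words.\<close>

inductive_set par :: "'v set \<Rightarrow> 'a set" for S where
  par_one: "\<one> \<in> par S"
| par_mult: "\<lbrakk>x \<in> par S; v \<in> S; v \<in> V; k \<in> H v\<rbrakk> \<Longrightarrow> k \<otimes> x \<in> par S"

lemma par_carrier: "x \<in> par S \<Longrightarrow> x \<in> carrier P"
  by (induction rule: par.induct) (auto simp: H_carrier)

lemma H_par: "\<lbrakk>v \<in> S; v \<in> V; k \<in> H v\<rbrakk> \<Longrightarrow> k \<in> par S"
  using par_mult[OF par_one, of v S k] H_carrier by simp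

lemma par_closed: "\<lbrakk>x \<in> par S; y \<in> par S\<rbrakk> \<Longrightarrow> x \<otimes> y \<in> par S"
proof (induction rule: par.induct)
  case par_one
  then show ?case using par_carrier by simp
next
  case (par_mult x v k)
  then show ?case by (simp add: m_assoc H_carrier par_carrier par.par_mult)
qed

lemma par_inv: "x \<in> par S \<Longrightarrow> inv x \<in> par S"
proof (induction rule: par.induct)
  case par_one
  then show ?case by (simp add: par.par_one)
next
  case (par_mult x v k)
  then show ?case by (simp add: inv_mult_group H_carrier par_carrier H_par H_inv par_closed)
qed

lemma par_reduced: "x \<in> par S \<Longrightarrow> \<exists>n. reduced S n x"
  by (induction rule: par.induct) (auto intro: reduced_one reduced_mult_syllable)

lemma par_front: "\<lbrakk>x \<in> par S; v \<in> V; front v x \<noteq> \<one>\<rbrakk> \<Longrightarrow> v \<in> S"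
  using par_reduced reduced_front by blast

text \<open>An initial syllable of a non-trivial \<open>x\<close> would have its vertex in every
  \<open>S i\<close>. Applied to the stars over a coneless set, this makes the common point of the
  cosets unique.\<close>

lemma par_Inter_trivial:
  assumes "x \<in> carrier P" "\<And>i. i \<in> I \<Longrightarrow> x \<in> par (S i)" "V \<inter> (\<Inter>i\<in>I. S i) = {}"
  shows "x = \<one>"
  using front_exists[OF assms(1)] par_front assms(2,3) by blast

section \<open>Links, stars and final syllables\<close>

definition lk :: "'v \<Rightarrow> 'v set" where "lk v = {u \<in> V. adj u v}"
definition st :: "'v \<Rightarrow> 'v set" where "st v = insert v (lk v)"

lemma par_lk_commute:
  assumes "x \<in> par (lk v)" "v \<in> V" "k \<in> H v"
  shows "x \<otimes> k = k \<otimes> x"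
  using assms(1)
proof (induction rule: par.induct)
  case par_one
  then show ?case using assms H_carrier by simp
next
  case (par_mult x u h)
  have c: "x \<in> carrier P" "h \<in> carrier P" "k \<in> carrier P"
    using par_mult assms by (auto simp: par_carrier H_carrier)
  have "h \<otimes> k = k \<otimes> h"
    using par_mult assms H_commute[of u v h k] by (simp add: lk_def)
  then show ?case using par_mult c by (metis m_assoc)
qed

lemma par_lk_front:
  assumes "x \<in> par (lk v)" "v \<in> V" "y \<in> carrier P"
  shows "front v (x \<otimes> y) = front v y"
  using assms(1)
proof (induction rule: par.induct)
  case par_one
  then show ?case using assms by simp
next
  case (par_mult x u h)
  then show ?case using front_adj[of u v h "x \<otimes> y"] assms
    by (simp add: m_assoc par_carrier H_carrier lk_def)
qed

text \<open>The subgroup \<open>par (st v)\<close> is generated by \<open>H v\<close> and by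
  syllables that commute with \<open>H v\<close>, so it normalizes \<open>H v\<close>.\<close>

lemma par_st_conj:
  assumes "x \<in> par (st v)" "v \<in> V" "k \<in> H v"
  shows "x \<otimes> k \<otimes> inv x \<in> H v"
  using assms(1)
proof (induction rule: par.induct)
  case par_one
  then show ?case using assms H_carrier by simp
next
  case (par_mult x u h)
  let ?y = "x \<otimes> k \<otimes> inv x"
  have c: "x \<in> carrier P" "h \<in> carrier P" "k \<in> carrier P"
    using par_mult assms by (auto simp: par_carrier H_carrier)
  have eq: "h \<otimes> x \<otimes> k \<otimes> inv (h \<otimes> x) = h \<otimes> ?y \<otimes> inv h"
    using c by (simp add: inv_mult_group m_assoc)
  show ?case
  proof (cases "u = v")
    case True
    then show ?thesis using eq par_mult H_mult H_inv assms by simp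
  next
    case False
    then have "h \<otimes> ?y = ?y \<otimes> h"
      using par_mult assms H_commute[of u v h ?y] by (simp add: st_def lk_def)
    then show ?thesis using eq par_mult c by (simp add: m_assoc)
  qed
qed

text \<open>This says that no reduced word for \<open>x\<close> ends in a syllable of \<open>H v\<close>.\<close>

definition rmin :: "'v \<Rightarrow> 'a \<Rightarrow> bool" where
  "rmin v x \<longleftrightarrow> (\<forall>k\<in>H v. len x \<le> len (x \<otimes> k))"

text \<open>Inversion preserves length and turns final syllables into initial ones, so right
  multiplication by \<open>H v\<close> can shorten \<open>x\<close> exactly when
  \<open>inv x\<close> begins at \<open>v\<close>.\<close>

lemma rmin_iff:
  assumes "v \<in> V" "x \<in> carrier P"
  shows "rmin v x \<longleftrightarrow> front v (inv x) = \<one>"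
proof
  assume r: "rmin v x"
  show "front v (inv x) = \<one>"
  proof (rule ccontr)
    let ?h = "front v (inv x)"
    assume "?h \<noteq> \<one>"
    then have "len (inv x) = Suc (len (inv ?h \<otimes> inv x))" using len_strip assms by simp
    moreover have "inv ?h \<otimes> inv x = inv (x \<otimes> ?h)" using assms by (simp add: inv_mult_group)
    ultimately have "len x = Suc (len (x \<otimes> ?h))" using assms by simp
    moreover have "len x \<le> len (x \<otimes> ?h)"
      using r front_H[of v "inv x"] assms unfolding rmin_def by simp
    ultimately show False by simp
  qed
next
  assume f: "front v (inv x) = \<one>"
  show "rmin v x" unfolding rmin_def
  proof
    fix k assume k: "k \<in> H v"
    then have c: "k \<in> carrier P" using assms H_carrier by blast
    have "len (x \<otimes> k) = len (inv k \<otimes> inv x)"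
      using c assms len_inv[of "x \<otimes> k"] by (simp add: inv_mult_group)
    moreover have "len (inv k \<otimes> inv x) \<ge> len (inv x)"
      using len_mult_syllable[of v "inv k" "inv x"] f assms k H_inv by (cases "inv k = \<one>") auto
    ultimately show "len x \<le> len (x \<otimes> k)" using assms by simp
  qed
qed

lemma rmin_tail:
  assumes "rmin v (k \<otimes> x)" "len (k \<otimes> x) = Suc (len x)" "r \<in> V" "k \<in> H r" "v \<in> V" "x \<in> carrier P"
  shows "rmin v x"
  unfolding rmin_def
proof
  fix m assume m: "m \<in> H v"
  then have c: "m \<in> carrier P" "k \<in> carrier P" using assms H_carrier by auto
  have "Suc (len x) \<le> len (k \<otimes> (x \<otimes> m))"
    using assms m c unfolding rmin_def by (auto simp: m_assoc)
  also have "\<dots> \<le> Suc (len (x \<otimes> m))" using len_mult_syllable_le assms c by simp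
  finally show "len x \<le> len (x \<otimes> m)" by simp
qed

text \<open>By hypothesis no final syllable of \<open>x\<close> can merge with an initial syllable
  of \<open>y\<close>, so reduced words for them can be concatenated. An initial syllable of the
  product either belongs to \<open>x\<close> or comes from \<open>y\<close> past all of
  \<open>x\<close>, which forces \<open>x\<close> into \<open>par (lk r)\<close>.\<close>

lemma reduced_product:
  assumes "x \<in> carrier P" "y \<in> carrier P" "\<And>v. \<lbrakk>v \<in> V; front v y \<noteq> \<one>\<rbrakk> \<Longrightarrow> rmin v x"
  shows "len (x \<otimes> y) = len x + len y \<and> (\<forall>r\<in>V. front r (x \<otimes> y) = front r x \<or> x \<in> par (lk r))"
  using assms(1,3)
proof (induction rule: len_induct)
  case one
  then show ?case using assms by (simp add: par_one)
next
  case (mult v k x)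
  have tail: "rmin w x" if "w \<in> V" "front w y \<noteq> \<one>" for w
    using that mult rmin_tail[of w k x v] by simp
  then have IH: "len (x \<otimes> y) = len x + len y"
    "\<And>r. r \<in> V \<Longrightarrow> front r (x \<otimes> y) = front r x \<or> x \<in> par (lk r)"
    using mult.IH by auto
  have xy: "x \<otimes> y \<in> carrier P" using mult assms by simp
  \<comment> \<open>An initial syllable of \<open>x \<otimes> y\<close> at \<open>v\<close> would
    have to come from \<open>y\<close> past \<open>x\<close>. Then \<open>x\<close> commutes with
    \<open>k\<close>, which makes \<open>k\<close> a final syllable of \<open>k \<otimes> x\<close>
    and contradicts \<open>rmin v (k \<otimes> x)\<close>.\<close>
  have f1: "front v (x \<otimes> y) = \<one>"
  proof (rule ccontr)
    assume n: "front v (x \<otimes> y) \<noteq> \<one>"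
    then have x: "x \<in> par (lk v)" using IH(2)[of v] mult.hyps by simp
    then have "front v y \<noteq> \<one>" using n par_lk_front mult assms by simp
    then have "rmin v (k \<otimes> x)" using mult by blast
    then have "len (k \<otimes> x) \<le> len (k \<otimes> x \<otimes> inv k)"
      using mult H_inv unfolding rmin_def by blast
    also have "k \<otimes> x \<otimes> inv k = x"
      using par_lk_commute[OF x] mult by (metis inv_solve_right m_closed)
    finally show False using mult by simp
  qed
  have eq: "k \<otimes> x \<otimes> y = k \<otimes> (x \<otimes> y)" using mult assms by (simp add: m_assoc)
  have fk: "front v (k \<otimes> (x \<otimes> y)) = k"
    using mult xy f1 by (simp add: reduced_front_mult)
  have "len (k \<otimes> x \<otimes> y) = len (k \<otimes> x) + len y"
    using len_mult_syllable[of v k "x \<otimes> y"] mult xy f1 IH eq by simp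
  moreover have "front r (k \<otimes> x \<otimes> y) = front r (k \<otimes> x) \<or> k \<otimes> x \<in> par (lk r)" if r: "r \<in> V" for r
  proof -
    consider "r = v" | "adj v r" | "r \<noteq> v" "\<not> adj v r" by blast
    then show ?thesis
    proof cases
      case 1
      then show ?thesis using eq fk mult by simp
    next
      case 2
      then show ?thesis
        using eq IH(2)[OF r] mult xy r front_adj[of v r k] par_mult[of x "lk r" v k]
        by (auto simp: lk_def)
    next
      case 3
      then show ?thesis
        using eq fk mult r xy front_nonadj_mult[of v r k "x \<otimes> y"] front_nonadj_mult[of v r k x] by auto
    qed
  qed
  ultimately show ?case by blast
qed

lemmas reduced_product_len = reduced_product[THEN conjunct1]
lemmas reduced_product_front = reduced_product[THEN conjunct2, rule_format]

text \<open>Nothing cancels between \<open>x\<close> and \<open>s\<close>, so the first syllable of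
  \<open>x\<close> is also initial in \<open>x \<otimes> s\<close> and hence has its vertex in
  \<open>T\<close>. Removing it from both elements gives the induction.\<close>

lemma par_prefix:
  assumes "x \<in> carrier P" "\<And>v. \<lbrakk>v \<in> V; v \<in> S\<rbrakk> \<Longrightarrow> rmin v x" "s \<in> par S" "x \<otimes> s \<in> par T"
  shows "x \<in> par T"
  using assms(1,2,4)
proof (induction rule: len_induct)
  case one
  then show ?case by (simp add: par_one)
next
  case (mult v k x)
  have s: "s \<in> carrier P" using assms par_carrier by blast
  have tail: "rmin w x" if "w \<in> V" "w \<in> S" for w
    using that mult rmin_tail[of w k x v] by simp
  have l1: "len (k \<otimes> x \<otimes> s) = len (k \<otimes> x) + len s"
    using mult s par_front assms(3) by (intro reduced_product_len) auto
  have l2: "len (x \<otimes> s) = len x + len s"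
    using mult s par_front assms(3) tail by (intro reduced_product_len) auto
  have eq: "k \<otimes> x \<otimes> s = k \<otimes> (x \<otimes> s)" using mult s by (simp add: m_assoc)
  have "front v (x \<otimes> s) = \<one>"
    using len_mult_le_if_front[of v k "x \<otimes> s"] mult s l1 l2 eq by force
  then have "front v (k \<otimes> x \<otimes> s) = k"
    using eq mult s reduced_front_mult by simp
  then have v: "v \<in> T" using mult par_front by metis
  have "inv k \<otimes> (k \<otimes> x \<otimes> s) \<in> par T"
    using v mult H_inv H_par par_closed by blast
  then have "x \<otimes> s \<in> par T" using mult s by (simp add: eq)
  then show ?case using mult tail v by (blast intro: par_mult)
qed

section \<open>Shortest coset representatives and the Helly property\<close>

lemma min_coset_rep:
  assumes "y \<in> carrier P"
  obtains s where "s \<in> par S" "\<And>v. \<lbrakk>v \<in> V; v \<in> S\<rbrakk> \<Longrightarrow> rmin v (y \<otimes> s)"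
proof -
  obtain s where s: "s \<in> par S" "\<And>s'. s' \<in> par S \<Longrightarrow> len (y \<otimes> s) \<le> len (y \<otimes> s')"
    using ex_has_least_nat[of "\<lambda>s. s \<in> par S" \<one> "\<lambda>s. len (y \<otimes> s)"] par_one by blast
  have "rmin v (y \<otimes> s)" if "v \<in> V" "v \<in> S" for v
    unfolding rmin_def
  proof
    fix k assume "k \<in> H v"
    then show "len (y \<otimes> s) \<le> len (y \<otimes> s \<otimes> k)"
      using s(2)[of "s \<otimes> k"] s(1) that assms par_closed H_par
      by (simp add: m_assoc par_carrier H_carrier)
  qed
  then show ?thesis using s(1) that by blast
qed

text \<open>The third hypothesis says that the cosets of \<open>c i\<close> and \<open>c j\<close>
  meet. In the induction a common point \<open>p\<close> of the earlier cosets is translated to the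
  identity. The shortest element of the translated new coset is then a prefix of an element of each
  earlier \<open>par (S i)\<close>, and \<open>par_prefix\<close> puts it into all of them.\<close>

lemma helly:
  assumes "finite I" "\<And>i. i \<in> I \<Longrightarrow> c i \<in> carrier P"
    and "\<And>i j. \<lbrakk>i \<in> I; j \<in> I\<rbrakk> \<Longrightarrow> \<exists>a\<in>par (S i). \<exists>b\<in>par (S j). inv (c i) \<otimes> c j = a \<otimes> b"
  shows "\<exists>x\<in>carrier P. \<forall>i\<in>I. inv (c i) \<otimes> x \<in> par (S i)"
  using assms
proof (induction I rule: finite_induct)
  case empty
  then show ?case by auto
next
  case (insert n I)
  then obtain p where p: "p \<in> carrier P" "\<And>i. i \<in> I \<Longrightarrow> inv (c i) \<otimes> p \<in> par (S i)"
    by (metis insert_iff)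
  have cn: "c n \<in> carrier P" using insert by simp
  define y where "y = inv p \<otimes> c n"
  have y: "y \<in> carrier P" using p cn y_def by simp
  obtain s where s: "s \<in> par (S n)" "\<And>v. \<lbrakk>v \<in> V; v \<in> S n\<rbrakk> \<Longrightarrow> rmin v (y \<otimes> s)"
    using min_coset_rep[OF y] by metis
  have sc: "s \<in> carrier P" using s par_carrier by blast
  have "inv (c i) \<otimes> (c n \<otimes> s) \<in> par (S i)" if i: "i \<in> I" for i
  proof -
    have ci: "c i \<in> carrier P" using insert i by simp
    obtain a b where ab: "a \<in> par (S i)" "b \<in> par (S n)" "inv (c i) \<otimes> c n = a \<otimes> b"
      using insert.prems(2)[of i n] i by auto
    have abc: "a \<in> carrier P" "b \<in> carrier P" using ab par_carrier by auto
    let ?q = "inv (c i) \<otimes> p"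
    have "y \<otimes> inv b = inv ?q \<otimes> a"
    proof -
      have "y = inv ?q \<otimes> (inv (c i) \<otimes> c n)"
        using p ci cn by (simp add: y_def inv_mult_group m_assoc)
      then show ?thesis using ab abc p ci by (simp add: m_assoc)
    qed
    then have "y \<otimes> inv b \<in> par (S i)" using p(2)[OF i] ab par_closed par_inv by metis
    moreover have "y \<otimes> inv b = (y \<otimes> s) \<otimes> (inv s \<otimes> inv b)"
      using y sc abc by (simp add: m_assoc)
    moreover have "inv s \<otimes> inv b \<in> par (S n)" using s ab par_inv par_closed by simp
    ultimately have "y \<otimes> s \<in> par (S i)"
      using par_prefix[of "y \<otimes> s" "S n" "inv s \<otimes> inv b" "S i"] s y sc by simp
    then have "?q \<otimes> (y \<otimes> s) \<in> par (S i)" using p(2)[OF i] par_closed by blast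
    then show ?thesis using p ci cn sc by (simp add: y_def m_assoc)
  qed
  moreover have "inv (c n) \<otimes> (c n \<otimes> s) \<in> par (S n)" using s cn sc by simp
  ultimately show ?case using cn sc by (intro bexI[of _ "c n \<otimes> s"]) auto
qed

section \<open>Products of two conjugated syllables\<close>

lemma pow_conj:
  assumes "t \<in> carrier P" "x \<in> carrier P"
  shows "(t \<otimes> x \<otimes> inv t) [^] (n::nat) = t \<otimes> x [^] n \<otimes> inv t"
  by (induction n) (use assms in \<open>simp_all add: m_assoc\<close>)

lemma len_pow_le: "x \<in> carrier P \<Longrightarrow> len (x [^] (n::nat)) \<le> n * len x"
proof (induction n)
  case (Suc n)
  then show ?case using len_mult_le[of "x [^] n" x] by simp
qed simp

lemma front_other_syllable:
  assumes "v \<in> V" "k \<in> H v" "r \<in> V" "r \<noteq> v"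
  shows "front r k = \<one>"
proof (cases "adj v r")
  case True
  then show ?thesis using front_adj[of v r k \<one>] assms by (simp add: H_carrier front_one)
next
  case False
  then show ?thesis
    using front_nonadj[of v r k] assms by (auto simp: H_carrier front_one front_syllable)
qed

lemma front_other_syllables:
  assumes "v \<in> V" "u \<in> V" "\<not> adj v u" "u \<noteq> v" "k \<in> H v" "k \<noteq> \<one>" "h \<in> H u" "r \<in> V" "r \<noteq> v"
  shows "front r (k \<otimes> h) = \<one>"
proof -
  have f: "front v (k \<otimes> h) = k"
    using assms by (intro reduced_front_mult front_other_syllable) (auto simp: H_carrier)
  show ?thesis
  proof (cases "adj v r")
    case True
    then show ?thesis
      using assms front_adj[of v r k h] front_other_syllable[of u h r] H_carrier by auto
  next
    case False
    then show ?thesis using assms f front_nonadj_mult[of v r k h] H_carrier by auto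
  qed
qed

text \<open>The element \<open>z\<close> has no initial syllable in \<open>st u\<close> and no final
  one in \<open>st v\<close>, so nothing merges. The second conclusion reproduces the assumption on
  \<open>y\<close> with \<open>u\<close> in place of \<open>v\<close>, which allows the step to be
  iterated.\<close>

lemma growth_step:
  assumes "u \<in> V" "v \<in> V" "g \<in> H u" "g \<noteq> \<one>" "z \<in> carrier P" "z \<noteq> \<one>" "y \<in> carrier P"
    and zl: "\<And>r. r \<in> st u \<Longrightarrow> r \<in> V \<Longrightarrow> front r z = \<one>"
    and zr: "\<And>r. r \<in> st v \<Longrightarrow> r \<in> V \<Longrightarrow> front r (inv z) = \<one>"
    and y: "\<And>r. r \<in> V \<Longrightarrow> r \<noteq> v \<Longrightarrow> front r y = \<one>"
  shows "len (g \<otimes> (z \<otimes> y)) = Suc (len z + len y)"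
    and "\<And>r. r \<in> V \<Longrightarrow> r \<noteq> u \<Longrightarrow> front r (g \<otimes> (z \<otimes> y)) = \<one>"
proof -
  have "rmin w z" if "w \<in> V" "front w y \<noteq> \<one>" for w
    using that y zr[of v] assms(2,5) by (auto simp: rmin_iff st_def)
  note prod = reduced_product[OF assms(5,7) this]
  \<comment> \<open>In the exceptional case \<open>z \<in> par (lk r)\<close> the vertex
    \<open>r\<close> differs from \<open>v\<close>, because the final syllables of \<open>z\<close>
    lie outside \<open>st v\<close>; then both fronts are trivial.\<close>
  have fr: "front r (z \<otimes> y) = front r z" if r: "r \<in> V" for r
  proof (cases "z \<in> par (lk r)")
    case True
    have "r \<noteq> v"
    proof
      assume "r = v"
      then have "inv z \<in> par (lk v)" using True par_inv by simp
      moreover obtain w where "w \<in> V" "front w (inv z) \<noteq> \<one>"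
        using front_exists[of "inv z"] assms(5,6) inv_neq_one by auto
      ultimately show False using par_front zr by (auto simp: st_def)
    qed
    then have "front r (z \<otimes> y) = \<one>" using par_lk_front[OF True r] assms(7) y r by simp
    moreover have "front r z = \<one>"
      using par_front[OF True r] adj_irrefl by (auto simp: lk_def)
    ultimately show ?thesis by simp
  next
    case False
    then show ?thesis using prod r by blast
  qed
  have zy: "z \<otimes> y \<in> carrier P" "front u (z \<otimes> y) = \<one>"
    using assms fr by (auto simp: st_def)
  show "len (g \<otimes> (z \<otimes> y)) = Suc (len z + len y)"
    using len_mult_syllable[of u g "z \<otimes> y"] zy prod assms by simp
  have fu: "front u (g \<otimes> (z \<otimes> y)) = g" using zy assms reduced_front_mult by simp
  fix r assume r: "r \<in> V" "r \<noteq> u"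
  show "front r (g \<otimes> (z \<otimes> y)) = \<one>"
  proof (cases "adj u r")
    case True
    then show ?thesis
      using front_adj[of u r g "z \<otimes> y"] zy fr zl[of r] assms r adj_sym
      by (simp add: st_def lk_def)
  next
    case False
    then show ?thesis using front_nonadj_mult[of u r g "z \<otimes> y"] zy fu assms r by simp
  qed
qed

text \<open>Each further power takes two applications of \<open>growth_step\<close>, first to
  \<open>h\<close> and \<open>inv z\<close>, then to \<open>g\<close> and \<open>z\<close>. The
  condition on fronts is carried along to feed the next power.\<close>

lemma growth:
  assumes "u \<in> V" "v \<in> V" "g \<in> H u" "g \<noteq> \<one>" "h \<in> H v" "h \<noteq> \<one>" "z \<in> carrier P" "z \<noteq> \<one>"
    and zl: "\<And>r. r \<in> st u \<Longrightarrow> r \<in> V \<Longrightarrow> front r z = \<one>"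
    and zr: "\<And>r. r \<in> st v \<Longrightarrow> r \<in> V \<Longrightarrow> front r (inv z) = \<one>"
  shows "len ((g \<otimes> (z \<otimes> (h \<otimes> inv z))) [^] (n::nat)) = n * (2 + 2 * len z)
    \<and> (\<forall>r\<in>V. r \<noteq> u \<longrightarrow> front r ((g \<otimes> (z \<otimes> (h \<otimes> inv z))) [^] n) = \<one>)"
proof (induction n)
  case 0
  then show ?case by (simp add: front_one)
next
  case (Suc n)
  let ?w = "g \<otimes> (z \<otimes> (h \<otimes> inv z))"
  let ?y = "?w [^] n"
  let ?y' = "h \<otimes> (inv z \<otimes> ?y)"
  have c: "g \<in> carrier P" "h \<in> carrier P" using assms H_carrier by auto
  have y: "?y \<in> carrier P" and y': "?y' \<in> carrier P" using c assms by auto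
  have "?w [^] Suc n = ?w \<otimes> ?y" by (rule nat_pow_Suc2) (use c assms in simp)
  then have eq: "?w [^] Suc n = g \<otimes> (z \<otimes> ?y')" using c y assms by (simp add: m_assoc)
  note s1 = growth_step[of v u h "inv z" ?y, OF assms(2,1,5,6)]
  have "len ?y' = Suc (len z + len ?y)" "\<And>r. r \<in> V \<Longrightarrow> r \<noteq> v \<Longrightarrow> front r ?y' = \<one>"
    using s1 y zl zr assms(7,8) inv_neq_one Suc by auto
  then have "len (g \<otimes> (z \<otimes> ?y')) = Suc (len z + Suc (len z + len ?y))"
    "\<And>r. r \<in> V \<Longrightarrow> r \<noteq> u \<Longrightarrow> front r (g \<otimes> (z \<otimes> ?y')) = \<one>"
    using growth_step[of u v g z ?y', OF assms(1-4,7,8) y'] zl zr by auto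
  then show ?case unfolding eq using Suc by simp
qed

text \<open>The conclusion says that the cosets \<open>par (st u)\<close> and
  \<open>w par (st v)\<close> meet. The element \<open>c\<close> will be a product of two syllables,
  which accounts for the bound on its length.\<close>

lemma elliptic_product_cosets:
  assumes "u \<in> V" "v \<in> V" "g \<in> H u" "g \<noteq> \<one>" "h \<in> H v" "h \<noteq> \<one>"
    and "w \<in> carrier P" "t \<in> carrier P" "c \<in> carrier P" "len c \<le> 2"
    and eq: "g \<otimes> (w \<otimes> h \<otimes> inv w) = t \<otimes> c \<otimes> inv t"
  shows "\<exists>a\<in>par (st u). \<exists>b\<in>par (st v). w = a \<otimes> b"
proof -
  have gh: "g \<in> carrier P" "h \<in> carrier P" using assms H_carrier by auto
  obtain a b where ab: "a \<in> par (st u)" "b \<in> par (st v)"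
    and min: "\<And>a' b'. \<lbrakk>a' \<in> par (st u); b' \<in> par (st v)\<rbrakk> \<Longrightarrow> len (a \<otimes> w \<otimes> b) \<le> len (a' \<otimes> w \<otimes> b')"
    using ex_has_least_nat[of "\<lambda>(a, b). a \<in> par (st u) \<and> b \<in> par (st v)" "(\<one>, \<one>)"
        "\<lambda>(a, b). len (a \<otimes> w \<otimes> b)"] par_one by auto
  have abc: "a \<in> carrier P" "b \<in> carrier P" using ab par_carrier by auto
  define z where "z = a \<otimes> w \<otimes> b"
  have z: "z \<in> carrier P" using abc assms z_def by simp
  \<comment> \<open>Minimality leaves no syllable of \<open>st u\<close> at the start of
    \<open>z\<close> and none of \<open>st v\<close> at its end.\<close>
  have zl: "front r z = \<one>" if "r \<in> st u" "r \<in> V" for r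
  proof (rule ccontr)
    assume n: "front r z \<noteq> \<one>"
    have "inv (front r z) \<otimes> a \<in> par (st u)"
      using ab that z par_mult front_H H_inv by blast
    from min[OF this ab(2)] len_strip[OF that(2) z n] show False
      using that z abc assms by (simp add: z_def m_assoc)
  qed
  have zr: "front r (inv z) = \<one>" if "r \<in> st v" "r \<in> V" for r
  proof -
    have "rmin r z" unfolding rmin_def
    proof
      fix k assume k: "k \<in> H r"
      then have "b \<otimes> k \<in> par (st v)" using ab that par_closed H_par by blast
      from min[OF ab(1) this] show "len z \<le> len (z \<otimes> k)"
        using abc assms that k H_carrier by (simp add: z_def m_assoc)
    qed
    then show ?thesis using rmin_iff that z by simp
  qed
  have "z = \<one>"
  proof (rule ccontr)
    assume z1: "z \<noteq> \<one>"
    \<comment> \<open>The conjugates stay in the vertex groups, since these are normalized by the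
      parabolic subgroups of the stars. With them the product, conjugated by \<open>a\<close>, takes
      the shape required by \<open>growth\<close>.\<close>
    define g' where "g' = a \<otimes> g \<otimes> inv a"
    define h' where "h' = inv b \<otimes> h \<otimes> inv (inv b)"
    have H': "g' \<in> H u" "h' \<in> H v"
      unfolding g'_def h'_def using ab assms par_st_conj par_inv by blast+
    have c': "g' \<in> carrier P" "h' \<in> carrier P" using H' assms H_carrier by auto
    have n1: "g' \<noteq> \<one>"
    proof
      assume "g' = \<one>"
      then have "inv a \<otimes> (g' \<otimes> a) = \<one>" using abc by simp
      then show False using abc gh assms by (simp add: g'_def m_assoc)
    qed
    have n2: "h' \<noteq> \<one>"
    proof
      assume "h' = \<one>"
      then have "b \<otimes> (h' \<otimes> inv b) = \<one>" using abc by simp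
      then show False using abc gh assms by (simp add: h'_def m_assoc)
    qed
    define W where "W = g' \<otimes> (z \<otimes> (h' \<otimes> inv z))"
    have "W = a \<otimes> (g \<otimes> (w \<otimes> h \<otimes> inv w)) \<otimes> inv a"
      using abc gh assms(7-9) by (simp add: W_def g'_def h'_def z_def m_assoc inv_mult_group)
    also have "\<dots> = (a \<otimes> t) \<otimes> c \<otimes> inv (a \<otimes> t)"
      unfolding eq using abc assms by (simp add: m_assoc inv_mult_group)
    finally have W: "W = (a \<otimes> t) \<otimes> c \<otimes> inv (a \<otimes> t)" .
    \<comment> \<open>With \<open>n = L + 1\<close> the upper bound \<open>2 L + 2 n\<close> for the
      power of a conjugate of \<open>c\<close> stays below the lower bound \<open>4 n\<close> from
      \<open>growth\<close>.\<close>
    let ?L = "len (a \<otimes> t)"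
    let ?n = "Suc ?L"
    have at: "a \<otimes> t \<in> carrier P" using abc assms by simp
    have "W [^] ?n = (a \<otimes> t) \<otimes> c [^] ?n \<otimes> inv (a \<otimes> t)"
      unfolding W by (rule pow_conj) (use at assms in auto)
    then have "len (W [^] ?n) \<le> len ((a \<otimes> t) \<otimes> c [^] ?n) + ?L"
      using len_mult_le[of "(a \<otimes> t) \<otimes> c [^] ?n" "inv (a \<otimes> t)"] at assms by simp
    also have "\<dots> \<le> ?L + len (c [^] ?n) + ?L"
      using len_mult_le[of "a \<otimes> t" "c [^] ?n"] at assms by simp
    also have "\<dots> \<le> ?L + ?n * 2 + ?L"
      using len_pow_le[of c ?n] assms mult_le_mono2[of "len c" 2 ?n] by linarith
    also have "\<dots> < ?n * 4" by simp
    also have "\<dots> \<le> ?n * (2 + 2 * len z)"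
    proof -
      have "len z \<noteq> 0" using reduced_len[OF z] z1 by (auto elim: reduced.cases)
      then show ?thesis by (intro mult_le_mono2) simp
    qed
    also have "\<dots> = len (W [^] ?n)"
      using growth[OF assms(1,2) H'(1) n1 H'(2) n2 z z1 zl zr, of ?n] unfolding W_def by simp
    finally show False by simp
  qed
  then have "inv a \<otimes> (z \<otimes> inv b) = inv a \<otimes> inv b" using abc by simp
  then have "w = inv a \<otimes> inv b" using abc assms by (simp add: z_def m_assoc)
  then show ?thesis using ab par_inv by blast
qed

section \<open>Conjugacy of products of two non-adjacent syllables\<close>

lemma right_decomposition:
  assumes "v \<in> V" "t \<in> carrier P"
  obtains s m where "t = s \<otimes> m" "s \<in> carrier P" "m \<in> H v" "m \<in> carrier P" "rmin v s"
    "m \<noteq> \<one> \<Longrightarrow> len s < len t"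
proof -
  let ?f = "front v (inv t)"
  let ?s = "t \<otimes> ?f"
  have f: "?f \<in> H v" "?f \<in> carrier P" using assms by (auto simp: front_H)
  have inv: "inv ?s = inv ?f \<otimes> inv t" using f assms by (simp add: inv_mult_group)
  have "rmin v ?s"
    using assms f inv front_stripped[of v "inv t"] by (simp add: rmin_iff)
  moreover have "len ?s < len t" if "inv ?f \<noteq> \<one>"
    using len_strip[of v "inv t"] that assms f inv len_inv[of ?s] by fastforce
  moreover have "t = ?s \<otimes> inv ?f" using assms f by (simp add: m_assoc)
  ultimately show ?thesis using that[of ?s "inv ?f"] assms f H_inv by simp
qed

text \<open>Induction on the length of the conjugator \<open>t\<close>. Cancelling an initial
  syllable of \<open>t\<close> turns \<open>g \<otimes> h\<close> into its cyclic permutation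
  \<open>h \<otimes> g\<close>, so both orders are carried in the hypothesis. If \<open>t\<close> is
  shortened neither in this way nor by \<open>m \<otimes> g' = \<one>\<close> on the right, initial
  syllables of the two sides are compared.\<close>

lemma conjugate_syllable_pairs:
  assumes "u \<in> V" "v \<in> V" "u \<noteq> v" "\<not> adj u v" "t \<in> carrier P"
    and "g \<in> H v" "g' \<in> H v" "h \<in> H u" "h' \<in> H u" "g \<noteq> \<one>" "g' \<noteq> \<one>" "h \<noteq> \<one>" "h' \<noteq> \<one>"
    and "t \<otimes> (g' \<otimes> h') = (g \<otimes> h) \<otimes> t \<or> t \<otimes> (g' \<otimes> h') = (h \<otimes> g) \<otimes> t"
  shows "g = g' \<and> h = h'"
  using assms
proof (induction "len t" arbitrary: t u v g h g' h' rule: less_induct)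
  case less
  note V = \<open>u \<in> V\<close> \<open>v \<in> V\<close> and uv = \<open>u \<noteq> v\<close> \<open>\<not> adj u v\<close> and t = \<open>t \<in> carrier P\<close>
  note mem = \<open>g \<in> H v\<close> \<open>g' \<in> H v\<close> \<open>h \<in> H u\<close> \<open>h' \<in> H u\<close>
  note ne = \<open>g \<noteq> \<one>\<close> \<open>g' \<noteq> \<one>\<close> \<open>h \<noteq> \<one>\<close> \<open>h' \<noteq> \<one>\<close>
  have vu: "v \<noteq> u" "\<not> adj v u" using uv adj_sym by auto
  have c: "g \<in> carrier P" "g' \<in> carrier P" "h \<in> carrier P" "h' \<in> carrier P"
    using V mem H_carrier by auto
  note IH = less.hyps[OF _ V uv _ mem ne]
  have strip: "len (inv k \<otimes> t) < len t" if "r \<in> V" "front r t = k" "k \<noteq> \<one>" for r k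
    using len_strip[of r t] that t by simp
  obtain s m where sm: "t = s \<otimes> m" "s \<in> carrier P" "m \<in> H v" "m \<in> carrier P" "rmin v s"
    "m \<noteq> \<one> \<Longrightarrow> len s < len t"
    using right_decomposition[OF V(2) t] by blast
  define y where "y = (m \<otimes> g') \<otimes> h'"
  have mg: "m \<otimes> g' \<in> H v" using sm mem H_mult V by simp
  have y: "y \<in> carrier P" "t \<otimes> (g' \<otimes> h') = s \<otimes> y"
    using sm c by (simp_all add: y_def m_assoc)
  have fy: "front r y = \<one>" if "m \<otimes> g' \<noteq> \<one>" "r \<in> V" "r \<noteq> v" for r
    unfolding y_def using V mem mg that uv vu by (intro front_other_syllables) auto
  have fsy: "front r (s \<otimes> y) = front r s" if "m \<otimes> g' \<noteq> \<one>" "r \<in> V" "s \<notin> par (lk r)" for r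
    using reduced_product_front[OF sm(2) y(1), of r] fy sm(5) that by blast
  have fsm: "front r t = front r s" if "r \<in> V" "s \<notin> par (lk r)" for r
    unfolding sm(1)
    using reduced_product_front[OF sm(2) sm(4), of r] front_other_syllable[OF V(2) sm(3)] sm(5) that
    by blast
  \<comment> \<open>When the final syllable \<open>m\<close> of \<open>t\<close> cancels
    \<open>g'\<close>, the conjugator becomes the shorter \<open>s\<close> and
    \<open>g' \<otimes> h'\<close> is replaced by \<open>h' \<otimes> g'\<close>.\<close>
  have mg1: "s \<otimes> (h' \<otimes> g') = x \<otimes> s"
    if "m \<otimes> g' = \<one>" "t \<otimes> (g' \<otimes> h') = x \<otimes> t" "x \<in> carrier P" for x
  proof -
    have "s \<otimes> (h' \<otimes> g') = (s \<otimes> y) \<otimes> g'"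
      using sm c that by (simp add: y_def m_assoc)
    also have "\<dots> = x \<otimes> (s \<otimes> (m \<otimes> g'))"
      using y that sm c by (simp add: m_assoc)
    finally show ?thesis using that sm by simp
  qed
  have m_ne: "m \<noteq> \<one>" if "m \<otimes> g' = \<one>" using that ne c by auto
  from less.prems(14) show ?case
  proof
    assume eq: "t \<otimes> (g' \<otimes> h') = (g \<otimes> h) \<otimes> t"
    consider "front v t = g" | "front u t = inv h" | "front v t \<noteq> g" "front u t \<noteq> inv h"
      by blast
    then show ?thesis
    proof cases
      case 1
      then show ?thesis
        using IH[of "inv g \<otimes> t"] strip[of v g] V ne t c eq by (simp add: m_assoc)
    next
      case 2
      then show ?thesis
        using IH[of "inv (inv h) \<otimes> t"] strip[of u "inv h"] V ne inv_neq_one t c eq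
        by (simp add: m_assoc)
    next
      case 3
      \<comment> \<open>Otherwise the front of \<open>t\<close> at \<open>u\<close> would be
        \<open>inv h\<close>, which is excluded here. So \<open>h \<otimes> t\<close> begins at
        \<open>u\<close>, hence not at \<open>v\<close>, and \<open>g\<close> stays in front of
        it.\<close>
      have "front u (h \<otimes> t) \<noteq> \<one>"
      proof
        assume "front u (h \<otimes> t) = \<one>"
        then have "h \<otimes> front u t = \<one>" using V mem t front_same by simp
        then show False using 3 V t c by (metis front_carrier inv_equality inv_inv)
      qed
      then have "front v (h \<otimes> t) = \<one>" using front_nonadj_mult[OF uv(2,1) V mem(3) t] by simp
      then have "front v (g \<otimes> (h \<otimes> t)) = g" using reduced_front_mult V mem c t by simp
      then have fg: "front v (s \<otimes> y) = g" using y eq c t by (simp add: m_assoc)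
      show ?thesis
      proof (cases "m \<otimes> g' = \<one>")
        case True
        have "s \<otimes> (h' \<otimes> g') = (g \<otimes> h) \<otimes> s" using mg1[OF True eq] c by simp
        \<comment> \<open>Solved for \<open>inv s\<close>, the equation is an instance of the second
          alternative with primed and unprimed syllables exchanged.\<close>
        then have "inv s \<otimes> (s \<otimes> (h' \<otimes> g')) \<otimes> inv s = inv s \<otimes> ((g \<otimes> h) \<otimes> s) \<otimes> inv s"
          by simp
        then have "inv s \<otimes> (g \<otimes> h) = (h' \<otimes> g') \<otimes> inv s"
          using sm c by (simp add: m_assoc)
        then show ?thesis
          using less.hyps[OF _ V uv _ mem(2,1,4,3) ne(2,1,4,3), of "inv s"] m_ne[OF True] sm by simp
      next
        case False
        show ?thesis
        proof (cases "s \<in> par (lk v)")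
          case True
          have "front v y = m \<otimes> g'"
            unfolding y_def using V mg mem uv c vu
            by (intro reduced_front_mult front_other_syllable) auto
          then have g: "g = m \<otimes> g'" using fg par_lk_front[OF True V(2) y(1)] by simp
          \<comment> \<open>Here \<open>s\<close> commutes with the syllables at \<open>v\<close>,
            so \<open>g = m \<otimes> g'\<close> cancels on both sides and
            \<open>s \<otimes> h' = h \<otimes> (m \<otimes> s)\<close> remains.\<close>
          have ms: "s \<otimes> m = m \<otimes> s" using par_lk_commute[OF True V(2) sm(3)] .
          have gs: "s \<otimes> g = g \<otimes> s" using par_lk_commute[OF True V(2) mem(1)] .
          have fs: "front r s = \<one>" if "r \<in> V" "\<not> adj r v" for r
            using par_front[OF True that(1)] that(2) by (auto simp: lk_def)
          have "g \<otimes> (s \<otimes> h') = g \<otimes> (h \<otimes> (m \<otimes> s))"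
          proof -
            have "g \<otimes> (s \<otimes> h') = (s \<otimes> g) \<otimes> h'"
              unfolding gs using c sm(2) by (simp add: m_assoc)
            also have "\<dots> = s \<otimes> y"
              using c sm(2) by (simp add: y_def g[symmetric] m_assoc)
            also have "\<dots> = (g \<otimes> h) \<otimes> (m \<otimes> s)"
              using y(2) eq sm(1) ms by simp
            also have "\<dots> = g \<otimes> (h \<otimes> (m \<otimes> s))"
              using c sm(2,4) by (simp add: m_assoc)
            finally show ?thesis .
          qed
          then have sh: "s \<otimes> h' = h \<otimes> (m \<otimes> s)" 
            using l_cancel[of g "s \<otimes> h'" "h \<otimes> (m \<otimes> s)"] c sm(2,4) by simp
          have fvs: "front v s = \<one>" using fs[OF V(2)] adj_irrefl by blast
          \<comment> \<open>A non-trivial \<open>m\<close> would give the right side length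
            \<open>len s + 2\<close>, while the left side has length at most
            \<open>len s + 1\<close>.\<close>
          have "m = \<one>"
          proof (rule ccontr)
            assume m: "m \<noteq> \<one>"
            have "front v (m \<otimes> s) = m"
              by (rule reduced_front_mult[OF V(2) sm(3,2) fvs])
            then have "front u (m \<otimes> s) = \<one>"
              using front_nonadj_mult[OF vu(2,1) V(2,1) sm(3,2)] m by simp
            then have "len (h \<otimes> (m \<otimes> s)) = Suc (len (m \<otimes> s))"
              using len_mult_syllable[OF V(1) mem(3) ne(3)] sm(2,4) by simp
            also have "len (m \<otimes> s) = Suc (len s)"
              by (rule len_mult_syllable[OF V(2) sm(3) m sm(2) fvs])
            finally show False
              using sh len_mult_le[of s h'] len_syllable_le[OF V(1) mem(4)] sm(2) c(4) by simp
          qed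
          then have sh: "s \<otimes> h' = h \<otimes> s" and g': "g = g'" using sh g sm(2) c(2) by simp_all
          \<comment> \<open>Since \<open>u\<close> is outside \<open>lk v\<close>, neither end of
            \<open>s\<close> carries a syllable at \<open>u\<close>. Comparing fronts at
            \<open>u\<close> in \<open>s \<otimes> h' = h \<otimes> s\<close> then forces
            \<open>s\<close> into \<open>par (lk u)\<close>, and \<open>h = h'\<close>
            follows.\<close>
          have fs1: "front u s = \<one>" and fs2: "front u (inv s) = \<one>"
            using fs[of u] par_front[OF par_inv[OF True] V(1)] uv(2) V(1)
            by (auto simp: lk_def)
          have "front u (h \<otimes> s) = h" by (rule reduced_front_mult[OF V(1) mem(3) sm(2) fs1])
          then have "front u (s \<otimes> h') = h" using sh by simp
          moreover have "front u (s \<otimes> h') = front u s \<or> s \<in> par (lk u)"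
            using front_other_syllable[OF V(1) mem(4)] fs2 V(1)
            by (intro reduced_product_front sm(2) c(4)) (use sm(2) in \<open>auto simp: rmin_iff\<close>)
          ultimately have "s \<in> par (lk u)" using fs1 ne(3) by simp
          then have "front u (s \<otimes> h') = h'"
            using par_lk_front[OF _ V(1) c(4)] front_syllable[OF V(1) mem(4)] by simp
          then show ?thesis using \<open>front u (s \<otimes> h') = h\<close> g' by simp
        next
          case s: False
          then show ?thesis using fsy[OF False V(2) s] fsm[OF V(2) s] fg 3 by simp
        qed
      qed
    qed
  next
    assume eq: "t \<otimes> (g' \<otimes> h') = (h \<otimes> g) \<otimes> t"
    consider "front u t = h" | "front v t = inv g" | "front u t \<noteq> h" "front v t \<noteq> inv g"
      by blast
    then show ?thesis
    proof cases
      case 1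
      then show ?thesis
        using IH[of "inv h \<otimes> t"] strip[of u h] V ne t c eq by (simp add: m_assoc)
    next
      case 2
      then show ?thesis
        using IH[of "inv (inv g) \<otimes> t"] strip[of v "inv g"] V ne inv_neq_one t c eq
        by (simp add: m_assoc)
    next
      case 3
      have "front v (g \<otimes> t) \<noteq> \<one>"
      proof
        assume "front v (g \<otimes> t) = \<one>"
        then have "g \<otimes> front v t = \<one>" using V mem t front_same by simp
        then show False using 3 V t c by (metis front_carrier inv_equality inv_inv)
      qed
      then have "front u (g \<otimes> t) = \<one>" using front_nonadj_mult[OF vu(2,1) V(2,1) mem(1) t] by simp
      then have "front u (h \<otimes> (g \<otimes> t)) = h" using reduced_front_mult V mem c t by simp
      then have fh: "front u (s \<otimes> y) = h" using y eq c t by (simp add: m_assoc)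
      show ?thesis
      proof (cases "m \<otimes> g' = \<one>")
        case True
        have "s \<otimes> (h' \<otimes> g') = (h \<otimes> g) \<otimes> s" using mg1[OF True eq] c by simp
        then show ?thesis
          using less.hyps[OF _ V(2,1) vu _ mem(3,4,1,2) ne(3,4,1,2), of s] m_ne[OF True] sm by simp
      next
        case False
        \<comment> \<open>Otherwise the syllable \<open>h\<close> would come from \<open>y\<close>,
          which begins only at \<open>v\<close>.\<close>
        have s: "s \<notin> par (lk u)"
        proof
          assume "s \<in> par (lk u)"
          then show False using par_lk_front[of s u y] fh fy[OF False] V y uv ne by simp
        qed
        show ?thesis using fsy[OF False V(1) s] fsm[OF V(1) s] fh 3 by simp
      qed
    qed
  qed
qed

section \<open>Pointwise inner endomorphisms\<close>

theorem pointwise_inner_imp_inner: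
  assumes hom: "\<phi> \<in> hom P P" and pw: "pointwise_inner P \<phi>"
    and U: "finite U" "U \<subseteq> V" and coneless: "V \<inter> (\<Inter>u\<in>U. st u) = {}"
    and nontrivial: "\<And>v. v \<in> V \<Longrightarrow> H v \<noteq> {\<one>}"
  shows "inner_automorphism P \<phi>"
proof -
  obtain c where c: "\<And>g. g \<in> carrier P \<Longrightarrow> c g \<in> carrier P"
    and \<phi>: "\<And>g. g \<in> carrier P \<Longrightarrow> \<phi> g = c g \<otimes> g \<otimes> inv (c g)"
    using pw unfolding pointwise_inner_def by metis
  have "\<exists>g. g \<in> H v \<and> g \<noteq> \<one>" if "v \<in> V" for v
    using nontrivial[OF that] H_one[OF that] by blast
  then obtain \<gamma> where \<gamma>: "\<And>v. v \<in> V \<Longrightarrow> \<gamma> v \<in> H v" "\<And>v. v \<in> V \<Longrightarrow> \<gamma> v \<noteq> \<one>" by metis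
  define Sy where "Sy = {(v, g). v \<in> V \<and> g \<in> H v \<and> g \<noteq> \<one>}"
  have Xc: "g \<in> carrier P" if "(v, g) \<in> Sy" for v g using that H_carrier by (auto simp: Sy_def)
  have meet: "\<exists>a\<in>par (st u). \<exists>b\<in>par (st v). inv (c g) \<otimes> c h = a \<otimes> b"
    if gh: "(u, g) \<in> Sy" "(v, h) \<in> Sy" for u v g h
  proof -
    have car: "g \<in> carrier P" "h \<in> carrier P" "c g \<in> carrier P" "c h \<in> carrier P"
      "g \<otimes> h \<in> carrier P" "c (g \<otimes> h) \<in> carrier P" using gh Xc c by auto
    have "len (g \<otimes> h) \<le> 2"
      using len_mult_le[OF car(1,2)] len_syllable_le[of u g] len_syllable_le[of v h] gh
      by (simp add: Sy_def)
    \<comment> \<open>This is \<open>\<phi> g \<otimes> \<phi> h = \<phi> (g \<otimes> h)\<close>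
      conjugated by \<open>inv (c g)\<close>, in the form required by
      \<open>elliptic_product_cosets\<close>.\<close>
    moreover have "g \<otimes> (inv (c g) \<otimes> c h \<otimes> h \<otimes> inv (inv (c g) \<otimes> c h))
        = (inv (c g) \<otimes> c (g \<otimes> h)) \<otimes> (g \<otimes> h) \<otimes> inv (inv (c g) \<otimes> c (g \<otimes> h))"
    proof -
      have "g \<otimes> (inv (c g) \<otimes> c h \<otimes> h \<otimes> inv (inv (c g) \<otimes> c h))
          = inv (c g) \<otimes> (\<phi> g \<otimes> \<phi> h) \<otimes> c g"
        using car by (simp add: \<phi> inv_mult_group m_assoc)
      also have "\<phi> g \<otimes> \<phi> h = \<phi> (g \<otimes> h)" using hom_mult[OF hom] car by simp
      finally show ?thesis using car by (simp add: \<phi> inv_mult_group m_assoc)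
    qed
    ultimately show ?thesis
      using gh car by (intro elliptic_product_cosets[where g = g and h = h and c = "g \<otimes> h"
        and t = "inv (c g) \<otimes> c (g \<otimes> h)"]) (auto simp: Sy_def)
  qed
  have common: "\<exists>x\<in>carrier P. \<forall>(v, g)\<in>I. inv (c g) \<otimes> x \<in> par (st v)"
    if "finite I" "I \<subseteq> Sy" for I
  proof -
    have "\<exists>x\<in>carrier P. \<forall>i\<in>I. inv ((\<lambda>i. c (snd i)) i) \<otimes> x \<in> par ((\<lambda>i. st (fst i)) i)"
      using that meet Xc c by (intro helly) (auto simp: subset_iff, blast)
    then show ?thesis by (auto simp: case_prod_beta)
  qed
  let ?I = "(\<lambda>u. (u, \<gamma> u)) ` U"
  have I: "finite ?I" "?I \<subseteq> Sy" using U \<gamma> by (auto simp: Sy_def)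
  from common[OF this] obtain x where x: "x \<in> carrier P"
    and xU: "\<And>u. u \<in> U \<Longrightarrow> inv (c (\<gamma> u)) \<otimes> x \<in> par (st u)" by auto
  \<comment> \<open>The Helly property covers finite families only, so each further syllable is
    added on its own to the family over \<open>U\<close>. Uniqueness over the coneless set shows
    that the new common point is \<open>x\<close> again.\<close>
  have xX: "inv (c g) \<otimes> x \<in> par (st v)" if vg: "(v, g) \<in> Sy" for v g
  proof -
    obtain x' where x': "x' \<in> carrier P" "inv (c g) \<otimes> x' \<in> par (st v)"
      "\<And>u. u \<in> U \<Longrightarrow> inv (c (\<gamma> u)) \<otimes> x' \<in> par (st u)"
      using common[of "insert (v, g) ?I"] I vg by auto
    have "inv x \<otimes> x' \<in> par (st u)" if u: "u \<in> U" for u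
    proof -
      have "c (\<gamma> u) \<in> carrier P" using u U \<gamma> H_carrier c by blast
      then have "inv x \<otimes> x' = inv (inv (c (\<gamma> u)) \<otimes> x) \<otimes> (inv (c (\<gamma> u)) \<otimes> x')"
        using x x' by (simp add: inv_mult_group m_assoc)
      then show ?thesis using xU[OF u] x'(3)[OF u] par_inv par_closed by simp
    qed
    then have "inv x \<otimes> x' = \<one>" using par_Inter_trivial[of "inv x \<otimes> x'" U st] x x' coneless by simp
    then have "x' = x" using x x' by (metis inv_cancel_right r_one)
    then show ?thesis using x' by simp
  qed
  define \<psi> where "\<psi> g = inv x \<otimes> \<phi> g \<otimes> x" for g
  have \<psi>: "\<psi> g \<in> H v" "\<psi> g \<noteq> \<one>" if vg: "(v, g) \<in> Sy" for v g
  proof -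
    have car: "g \<in> carrier P" "c g \<in> carrier P" using vg Xc c by auto
    let ?k = "inv (inv (c g) \<otimes> x)"
    have "\<psi> g = ?k \<otimes> g \<otimes> inv ?k"
      using car x by (simp add: \<psi>_def \<phi> inv_mult_group m_assoc)
    moreover have "?k \<in> par (st v)" using xX[OF vg] par_inv by blast
    ultimately show "\<psi> g \<in> H v" using par_st_conj[of ?k v g] vg by (simp add: Sy_def)
    show "\<psi> g \<noteq> \<one>"
    proof
      assume "\<psi> g = \<one>"
      then have "?k \<otimes> g \<otimes> inv ?k = \<one>" using \<open>\<psi> g = ?k \<otimes> g \<otimes> inv ?k\<close> by simp
      then have "inv ?k \<otimes> (?k \<otimes> g \<otimes> inv ?k) \<otimes> ?k = \<one>" using car x by simp
      then have "g = \<one>" using car x by (simp add: m_assoc)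
      then show False using vg by (simp add: Sy_def)
    qed
  qed
  have gen: "\<phi> g = x \<otimes> g \<otimes> inv x" if vg: "v \<in> V" "g \<in> H v" for v g
  proof (cases "g = \<one>")
    case True
    then show ?thesis using \<phi>[of \<one>] c[of \<one>] x by simp
  next
    case False
    then have gX: "(v, g) \<in> Sy" using vg by (simp add: Sy_def)
    obtain u where u: "u \<in> U" "v \<notin> st u" using coneless vg by blast
    have uV: "u \<in> V" "u \<noteq> v" "\<not> adj u v"
      using u U vg adj_sym by (auto simp: st_def lk_def)
    let ?h = "\<gamma> u"
    have hX: "(u, ?h) \<in> Sy" using uV \<gamma> by (simp add: Sy_def)
    have car: "g \<in> carrier P" "?h \<in> carrier P" "c (g \<otimes> ?h) \<in> carrier P" "\<phi> g \<in> carrier P" "\<phi> ?h \<in> carrier P"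
      using gX hX Xc c \<phi> by auto
    \<comment> \<open>This element conjugates \<open>\<psi> g \<otimes> \<psi> ?h\<close> to
      \<open>g \<otimes> ?h\<close>, as in the first alternative of
      \<open>conjugate_syllable_pairs\<close>.\<close>
    let ?t = "inv (c (g \<otimes> ?h)) \<otimes> x"
    have "?t \<otimes> (\<psi> g \<otimes> \<psi> ?h) = inv (c (g \<otimes> ?h)) \<otimes> (\<phi> g \<otimes> \<phi> ?h) \<otimes> x"
      using car x by (simp add: \<psi>_def m_assoc)
    also have "\<phi> g \<otimes> \<phi> ?h = \<phi> (g \<otimes> ?h)" using hom_mult[OF hom] car by simp
    finally have "?t \<otimes> (\<psi> g \<otimes> \<psi> ?h) = (g \<otimes> ?h) \<otimes> ?t" using car x by (simp add: \<phi> m_assoc)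
    then have "g = \<psi> g"
      using conjugate_syllable_pairs[of u v ?t g "\<psi> g" ?h "\<psi> ?h"] uV vg \<psi>[OF gX] \<psi>[OF hX] \<gamma>[of u]
        False car x by simp
    then have "x \<otimes> g \<otimes> inv x = x \<otimes> \<psi> g \<otimes> inv x" by simp
    then show ?thesis using car x by (simp add: \<psi>_def m_assoc)
  qed
  have "\<phi> g = x \<otimes> g \<otimes> inv x" if "g \<in> carrier P" for g
    using that
  proof (rule H_generate)
    show "\<phi> \<one> = x \<otimes> \<one> \<otimes> inv x" using \<phi>[of \<one>] c[of \<one>] x by simp
  next
    fix v k y assume k: "v \<in> V" "k \<in> H v" and y: "y \<in> carrier P" "\<phi> y = x \<otimes> y \<otimes> inv x"
    have kc: "k \<in> carrier P" using k H_carrier by blast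
    have "\<phi> (k \<otimes> y) = \<phi> k \<otimes> \<phi> y" using hom_mult[OF hom] kc y by simp
    also have "\<dots> = x \<otimes> (k \<otimes> y) \<otimes> inv x"
      using gen[OF k] y kc x by (simp add: m_assoc)
    finally show "\<phi> (k \<otimes> y) = x \<otimes> (k \<otimes> y) \<otimes> inv x" .
  qed
  then show ?thesis using x unfolding inner_automorphism_def by blast
qed

end
section \<open>Reduced words of a graph product\<close>

locale graph_of_groups =
  fixes V :: "'v set" and E :: "'v set set" and G :: "'v \<Rightarrow> ('a, 'b) monoid_scheme"
  assumes simplicial: "simplicial_graph V E"
    and grp: "\<forall>v\<in>V. group (G v)"
begin

lemma edge: "{u, v} \<in> E \<Longrightarrow> u \<in> V \<and> v \<in> V \<and> u \<noteq> v"
  using simplicial by (auto simp: simplicial_graph_def nsets_def)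

lemma no_loop [simp]: "{v} \<notin> E"
  using edge[of v v] by auto

lemma G_group: "v \<in> V \<Longrightarrow> group (G v)"
  using grp by blast

lemma vertex_group_simps [simp]:
  "\<lbrakk>v \<in> V; g \<in> carrier (G v); h \<in> carrier (G v)\<rbrakk> \<Longrightarrow> g \<otimes>\<^bsub>G v\<^esub> h \<in> carrier (G v)"
  "v \<in> V \<Longrightarrow> \<one>\<^bsub>G v\<^esub> \<in> carrier (G v)"
  "\<lbrakk>v \<in> V; g \<in> carrier (G v)\<rbrakk> \<Longrightarrow> inv\<^bsub>G v\<^esub> g \<in> carrier (G v)"
  "\<lbrakk>v \<in> V; g \<in> carrier (G v)\<rbrakk> \<Longrightarrow> \<one>\<^bsub>G v\<^esub> \<otimes>\<^bsub>G v\<^esub> g = g"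
  "\<lbrakk>v \<in> V; g \<in> carrier (G v)\<rbrakk> \<Longrightarrow> g \<otimes>\<^bsub>G v\<^esub> \<one>\<^bsub>G v\<^esub> = g"
  "\<lbrakk>v \<in> V; g \<in> carrier (G v)\<rbrakk> \<Longrightarrow> g \<otimes>\<^bsub>G v\<^esub> inv\<^bsub>G v\<^esub> g = \<one>\<^bsub>G v\<^esub>"
  "\<lbrakk>v \<in> V; g \<in> carrier (G v)\<rbrakk> \<Longrightarrow> inv\<^bsub>G v\<^esub> g \<otimes>\<^bsub>G v\<^esub> g = \<one>\<^bsub>G v\<^esub>"
  by (auto dest: G_group simp: group.is_monoid monoid.m_closed monoid.one_closed monoid.l_one
      monoid.r_one group.inv_closed group.r_inv group.l_inv)

text \<open>\<open>head v w\<close> is the syllable of \<open>v\<close> that can be shuffled to the front of the reduced word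
  \<open>w\<close>, or \<open>\<one>\<close> if there is none; \<open>tail v w\<close> is what remains.\<close>

fun head :: "'v \<Rightarrow> ('v \<times> 'a) list \<Rightarrow> 'a" where
  "head v [] = \<one>\<^bsub>G v\<^esub>"
| "head v ((u, g) # w) = (if u = v then g else if {u, v} \<in> E then head v w else \<one>\<^bsub>G v\<^esub>)"

fun tail :: "'v \<Rightarrow> ('v \<times> 'a) list \<Rightarrow> ('v \<times> 'a) list" where
  "tail v [] = []"
| "tail v ((u, g) # w) = (if u = v then w else if {u, v} \<in> E then (u, g) # tail v w else (u, g) # w)"

fun reduced_word :: "('v \<times> 'a) list \<Rightarrow> bool" where
  "reduced_word [] = True"
| "reduced_word ((v, g) # w) \<longleftrightarrow> v \<in> V \<and> g \<in> carrier (G v) \<and> g \<noteq> \<one>\<^bsub>G v\<^esub> \<and> head v w = \<one>\<^bsub>G v\<^esub>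
    \<and> reduced_word w"

text \<open>A swap takes place at the front of an arbitrary word, and \<open>shuffle_cons\<close>
  moves it to any position. Reduced words serve as normal forms only up to this relation.\<close>

inductive shuffle :: "('v \<times> 'a) list \<Rightarrow> ('v \<times> 'a) list \<Rightarrow> bool" where
  shuffle_refl [simp]: "shuffle w w"
| shuffle_sym: "shuffle w w' \<Longrightarrow> shuffle w' w"
| shuffle_trans [trans]: "\<lbrakk>shuffle w w'; shuffle w' w''\<rbrakk> \<Longrightarrow> shuffle w w''"
| shuffle_swap: "{u, v} \<in> E \<Longrightarrow> shuffle ((u, g) # (v, h) # w) ((v, h) # (u, g) # w)"
| shuffle_cons: "shuffle w w' \<Longrightarrow> shuffle (p # w) (p # w')"

lemma head_shuffle: "shuffle w w' \<Longrightarrow> head v w = head v w'"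
proof (induction rule: shuffle.induct)
  case (shuffle_swap u x g h w)
  then show ?case using edge[of u x] by (auto simp: insert_commute)
next
  case (shuffle_cons w w' p)
  then show ?case by (cases p) simp
qed simp_all

lemma tail_shuffle: "shuffle w w' \<Longrightarrow> shuffle (tail v w) (tail v w')"
proof (induction rule: shuffle.induct)
  case (shuffle_swap u x g h w)
  then show ?case using edge[of u x]
    by (auto simp: insert_commute intro: shuffle.shuffle_swap)
next
  case (shuffle_cons w w' p)
  then show ?case by (cases p) (simp add: shuffle.shuffle_cons)
qed (auto intro: shuffle_sym shuffle_trans)

lemma head_carrier [simp]: "\<lbrakk>reduced_word w; v \<in> V\<rbrakk> \<Longrightarrow> head v w \<in> carrier (G v)"
  by (induction w rule: reduced_word.induct) auto

lemma tail_id: "\<lbrakk>reduced_word w; head v w = \<one>\<^bsub>G v\<^esub>\<rbrakk> \<Longrightarrow> tail v w = w"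
  by (induction w rule: reduced_word.induct) (auto split: if_splits)

lemma head_tail: "reduced_word w \<Longrightarrow> head v (tail v w) = \<one>\<^bsub>G v\<^esub>"
  by (induction w rule: reduced_word.induct) auto

lemma head_tail_adj: "{u, v} \<in> E \<Longrightarrow> head u (tail v w) = head u w"
  by (induction v w rule: tail.induct) (auto simp: insert_commute)

lemma tail_tail: "{u, v} \<in> E \<Longrightarrow> tail u (tail v w) = tail v (tail u w)"
  by (induction v w rule: tail.induct) (auto simp: insert_commute)

lemma reduced_word_tail: "reduced_word w \<Longrightarrow> reduced_word (tail v w)"
  by (induction w rule: reduced_word.induct) (auto simp: head_tail_adj)

text \<open>A syllable at one of the two vertices blocks every later syllable at the other.\<close>

lemma head_nonadj:
  "\<lbrakk>u \<noteq> v; {u, v} \<notin> E\<rbrakk> \<Longrightarrow> head u w = \<one>\<^bsub>G u\<^esub> \<or> head v w = \<one>\<^bsub>G v\<^esub>"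
  by (induction w rule: reduced_word.induct) (auto simp: insert_commute)

lemma shuffle_head_tail:
  "\<lbrakk>reduced_word w; head v w \<noteq> \<one>\<^bsub>G v\<^esub>\<rbrakk> \<Longrightarrow> shuffle ((v, head v w) # tail v w) w"
proof (induction w rule: reduced_word.induct)
  case (2 u g w)
  show ?case
  proof (cases "u = v")
    case False
    then have uv: "{u, v} \<in> E" using 2 by (auto split: if_splits)
    then have "shuffle ((v, head v w) # (u, g) # tail v w) ((u, g) # (v, head v w) # tail v w)"
      by (intro shuffle_swap) (simp add: insert_commute)
    also have "shuffle \<dots> ((u, g) # w)" using 2 uv False by (intro shuffle_cons) auto
    finally show ?thesis using uv False by simp
  qed simp
qed simp

text \<open>Left multiplication by a syllable, on reduced words. Letting the group act on normal
  forms (van der Waerden's method) replaces a confluence argument for rewriting.\<close>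

definition act :: "'v \<Rightarrow> 'a \<Rightarrow> ('v \<times> 'a) list \<Rightarrow> ('v \<times> 'a) list" where
  "act v g w = (let k = g \<otimes>\<^bsub>G v\<^esub> head v w in if k = \<one>\<^bsub>G v\<^esub> then tail v w else (v, k) # tail v w)"

lemma act_shuffle: "shuffle w w' \<Longrightarrow> shuffle (act v g w) (act v g w')"
  using head_shuffle[of w w' v] by (auto simp: act_def Let_def intro: tail_shuffle shuffle_cons)

lemma reduced_word_act:
  "\<lbrakk>reduced_word w; v \<in> V; g \<in> carrier (G v)\<rbrakk> \<Longrightarrow> reduced_word (act v g w)"
  by (simp add: act_def Let_def reduced_word_tail head_tail)

lemma act_one: "\<lbrakk>reduced_word w; v \<in> V\<rbrakk> \<Longrightarrow> shuffle (act v \<one>\<^bsub>G v\<^esub> w) w"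
  using tail_id[of w v] shuffle_head_tail[of w v] by (auto simp: act_def Let_def)

lemma head_act:
  "\<lbrakk>reduced_word w; v \<in> V; g \<in> carrier (G v)\<rbrakk> \<Longrightarrow> head v (act v g w) = g \<otimes>\<^bsub>G v\<^esub> head v w"
  by (simp add: act_def Let_def head_tail)

lemma tail_act: "reduced_word w \<Longrightarrow> tail v (act v g w) = tail v w"
  by (simp add: act_def Let_def head_tail tail_id reduced_word_tail)

lemma head_act_adj: "{u, v} \<in> E \<Longrightarrow> head v (act u g w) = head v w"
  using edge[of u v] by (auto simp: act_def Let_def head_tail_adj insert_commute)

lemma act_mult:
  assumes "reduced_word w" "v \<in> V" "g \<in> carrier (G v)" "h \<in> carrier (G v)"
  shows "act v g (act v h w) = act v (g \<otimes>\<^bsub>G v\<^esub> h) w"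
  using assms group.is_monoid[OF G_group[of v]] monoid.m_assoc[of "G v" g h "head v w"]
  unfolding act_def[of v g] act_def[of v "g \<otimes>\<^bsub>G v\<^esub> h"] by (simp add: head_act tail_act Let_def)

lemma act_commute:
  assumes "{u, v} \<in> E"
  shows "shuffle (act u g (act v h w)) (act v h (act u g w))"
proof -
  have vu: "{v, u} \<in> E" using assms by (simp add: insert_commute)
  have t: "tail u (act v h w) = (if h \<otimes>\<^bsub>G v\<^esub> head v w = \<one>\<^bsub>G v\<^esub> then tail u (tail v w)
      else (v, h \<otimes>\<^bsub>G v\<^esub> head v w) # tail u (tail v w))"
    "tail v (act u g w) = (if g \<otimes>\<^bsub>G u\<^esub> head u w = \<one>\<^bsub>G u\<^esub> then tail u (tail v w)
      else (u, g \<otimes>\<^bsub>G u\<^esub> head u w) # tail u (tail v w))"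
    using assms vu edge[OF assms] tail_tail[OF assms] by (auto simp: act_def Let_def)
  show ?thesis
    unfolding act_def[of u g "act v h w"] act_def[of v h "act u g w"] t
      head_act_adj[OF assms] head_act_adj[OF vu]
    using assms by (simp add: Let_def shuffle_swap)
qed

section \<open>The action of words on reduced words\<close>

definition word_act :: "('v \<times> 'a) list \<Rightarrow> ('v \<times> 'a) list \<Rightarrow> ('v \<times> 'a) list" where
  "word_act w r = foldr (\<lambda>(v, g). act v g) w r"

lemma word_act_simps [simp]:
  "word_act [] r = r" "word_act ((v, g) # w) r = act v g (word_act w r)"
  "word_act (a @ b) r = word_act a (word_act b r)"
  by (simp_all add: word_act_def)

lemma words_simps [simp]:
  "[] \<in> syllable_words V G"
  "(v, g) # w \<in> syllable_words V G \<longleftrightarrow> v \<in> V \<and> g \<in> carrier (G v) \<and> w \<in> syllable_words V G"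
  "a @ b \<in> syllable_words V G \<longleftrightarrow> a \<in> syllable_words V G \<and> b \<in> syllable_words V G"
  by (auto simp: syllable_words_def)

lemma reduced_word_word_act:
  "\<lbrakk>w \<in> syllable_words V G; reduced_word r\<rbrakk> \<Longrightarrow> reduced_word (word_act w r)"
  by (induction w) (auto simp: reduced_word_act)

lemma word_act_shuffle: "shuffle r r' \<Longrightarrow> shuffle (word_act w r) (word_act w r')"
  by (induction w) (auto simp: act_shuffle)

text \<open>Testing all reduced words, rather than the empty one alone, makes the relation
  compatible with words appended on the right, which act first.\<close>

definition act_equiv :: "('v \<times> 'a) list \<Rightarrow> ('v \<times> 'a) list \<Rightarrow> bool" where
  "act_equiv w w' \<longleftrightarrow> (\<forall>r. reduced_word r \<longrightarrow> shuffle (word_act w r) (word_act w' r))"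

lemma act_equiv_sym: "act_equiv w w' \<Longrightarrow> act_equiv w' w"
  by (auto simp: act_equiv_def intro: shuffle_sym)

lemma act_equiv_trans [trans]: "\<lbrakk>act_equiv w w'; act_equiv w' w''\<rbrakk> \<Longrightarrow> act_equiv w w''"
  by (auto simp: act_equiv_def intro: shuffle_trans)

lemma act_equiv_append:
  assumes "act_equiv w w'" "b \<in> syllable_words V G"
  shows "act_equiv (a @ w @ b) (a @ w' @ b)"
  using assms by (auto simp: act_equiv_def intro!: word_act_shuffle reduced_word_word_act)

lemma act_equiv_free_product_rel:
  "(w, w') \<in> free_product_rel V G \<Longrightarrow> act_equiv w w'"
proof (induction rule: free_product_rel.induct)
  case (unit xs ys v)
  then have "act_equiv [(v, \<one>\<^bsub>G v\<^esub>)] []" by (simp add: act_equiv_def act_one)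
  from act_equiv_append[OF this unit(2), of xs] show ?case by simp
next
  case (mult xs ys v g h)
  then have "act_equiv [(v, g), (v, h)] [(v, g \<otimes>\<^bsub>G v\<^esub> h)]" by (simp add: act_equiv_def act_mult)
  from act_equiv_append[OF this mult(2), of xs] show ?case by simp
qed (auto simp: act_equiv_def intro: shuffle_sym shuffle_trans)

section \<open>The graph product as a group with syllable decompositions\<close>

abbreviation "F \<equiv> free_product V G"
abbreviation "N \<equiv> normal_closure F (graph_product_relators V E G)"
abbreviation "P \<equiv> graph_product V E G"

section \<open>Evaluation of words in the graph product\<close>

definition cls :: "('v \<times> 'a) list \<Rightarrow> ('v \<times> 'a) list set" where
  "cls w = free_product_rel V G `` {w}"

definition ev :: "('v \<times> 'a) list \<Rightarrow> ('v \<times> 'a) list set set" where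
  "ev w = N #>\<^bsub>F\<^esub> cls w"

sublocale F: group F by (rule group_free_product[OF grp])
sublocale P: group P by (rule group_graph_product[OF grp])

lemma cls_carrier [simp]: "w \<in> syllable_words V G \<Longrightarrow> cls w \<in> carrier F"
  by (simp add: cls_def free_product_carrierI)

lemma cls_append:
  "\<lbrakk>a \<in> syllable_words V G; b \<in> syllable_words V G\<rbrakk> \<Longrightarrow> cls (a @ b) = cls a \<otimes>\<^bsub>F\<^esub> cls b"
  by (simp add: cls_def free_product_mult_class[OF grp])

lemma cls_Nil: "cls [] = \<one>\<^bsub>F\<^esub>"
  by (simp add: cls_def free_product_def)

lemma cls_eqD:
  "\<lbrakk>cls a = cls b; a \<in> syllable_words V G\<rbrakk> \<Longrightarrow> (b, a) \<in> free_product_rel V G"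
  using equiv_free_product_rel[OF grp] free_product_rel.refl[of a V G] unfolding cls_def by blast

lemma cls_surj:
  assumes "x \<in> carrier F"
  obtains w where "w \<in> syllable_words V G" "x = cls w"
  using assms by (auto simp: cls_def elim: free_product_carrierE)

lemma cls_syllable: "cls [(v, g)] = free_product_incl V G v g"
  by (simp add: cls_def free_product_incl_def)

lemma N_normal: "N \<lhd> F"
  by (rule F.normal_closure_normal[OF graph_product_relators_carrier[OF grp]])

text \<open>The words that act trivially represent a subgroup of the free product. It contains all
  conjugates of the commutator relators, hence all of \<open>N\<close>.\<close>

lemma N_acts_trivially:
  assumes "x \<in> N"
  obtains m where "m \<in> syllable_words V G" "x = cls m" "act_equiv m []"
proof -
  \<comment> \<open>the kernel of the action of the free product on reduced words up to shuffling\<close>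
  let ?K = "{cls m |m. m \<in> syllable_words V G \<and> act_equiv m []}"
  have "subgroup ?K F"
  proof (rule F.subgroupI)
    show "?K \<subseteq> carrier F" by auto
    show "?K \<noteq> {}" by (auto simp: act_equiv_def intro!: exI[of _ "[]"])
  next
    fix x assume "x \<in> ?K"
    then obtain m where m: "m \<in> syllable_words V G" "act_equiv m []" "x = cls m" by blast
    obtain m' where m': "m' \<in> syllable_words V G" "inv\<^bsub>F\<^esub> x = cls m'"
      using cls_surj[of "inv\<^bsub>F\<^esub> x"] m by auto
    have "cls [] = cls (m @ m')"
      using m m' F.r_inv[of x] by (simp add: cls_append cls_Nil)
    then have "act_equiv (m @ m') []" using act_equiv_free_product_rel cls_eqD by simp
    moreover have "act_equiv (m @ m') m'" using act_equiv_append[OF m(2) m'(1), of "[]"] by simp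
    ultimately have "act_equiv m' []" by (blast intro: act_equiv_trans act_equiv_sym)
    then show "inv\<^bsub>F\<^esub> x \<in> ?K" using m' by blast
  next
    fix x y assume "x \<in> ?K" "y \<in> ?K"
    then obtain m n where m: "m \<in> syllable_words V G" "act_equiv m []" "x = cls m"
      and n: "n \<in> syllable_words V G" "act_equiv n []" "y = cls n" by blast
    have "act_equiv (m @ n) n" using act_equiv_append[OF m(2) n(1), of "[]"] by simp
    then have "act_equiv (m @ n) []" using n by (blast intro: act_equiv_trans)
    then show "x \<otimes>\<^bsub>F\<^esub> y \<in> ?K" using m n cls_append[of m n]
      by (auto intro!: exI[of _ "m @ n"])
  qed
  moreover have "{x \<otimes>\<^bsub>F\<^esub> s \<otimes>\<^bsub>F\<^esub> inv\<^bsub>F\<^esub> x | x s. x \<in> carrier F \<and> s \<in> graph_product_relators V E G} \<subseteq> ?K"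
  proof clarify
    fix x s assume x: "x \<in> carrier F" and "s \<in> graph_product_relators V E G"
    then obtain u v g h where uv: "u \<in> V" "v \<in> V" "{u, v} \<in> E" "g \<in> carrier (G u)" "h \<in> carrier (G v)"
      and s: "s = free_product_incl V G u g \<otimes>\<^bsub>F\<^esub> free_product_incl V G v h
       \<otimes>\<^bsub>F\<^esub> inv\<^bsub>F\<^esub> (free_product_incl V G u g) \<otimes>\<^bsub>F\<^esub> inv\<^bsub>F\<^esub> (free_product_incl V G v h)"
      by (auto simp: graph_product_relators_def)
    have incl_inv: "inv\<^bsub>F\<^esub> (cls [(w, k)]) = cls [(w, inv\<^bsub>G w\<^esub> k)]"
      if "w \<in> V" "k \<in> carrier (G w)" for w k
      using that group_hom.hom_inv[OF group_hom.intro[OF G_group[of w] F.is_group]]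
        free_product_incl_hom[OF grp, of w] by (simp add: group_hom_axioms_def cls_syllable)
    let ?r = "[(u, g), (v, h), (u, inv\<^bsub>G u\<^esub> g), (v, inv\<^bsub>G v\<^esub> h)]"
    have s_cls: "s = cls ?r"
      using uv cls_append[of "[(u, g)]" "[(v, h)]"]
        cls_append[of "[(u, g), (v, h)]" "[(u, inv\<^bsub>G u\<^esub> g)]"]
        cls_append[of "[(u, g), (v, h), (u, inv\<^bsub>G u\<^esub> g)]" "[(v, inv\<^bsub>G v\<^esub> h)]"]
      by (simp add: s incl_inv cls_syllable[symmetric])
    have "act_equiv ?r []" unfolding act_equiv_def
    proof (intro allI impI)
      fix r assume r: "reduced_word r"
      let ?r1 = "act v (inv\<^bsub>G v\<^esub> h) r"
      have r1: "reduced_word ?r1" using r uv by (simp add: reduced_word_act)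
      \<comment> \<open>The actions of \<open>h\<close> at \<open>v\<close> and of the inverse of
        \<open>g\<close> at \<open>u\<close> commute up to shuffling; exchanging them brings the
        inverse pairs together.\<close>
      have "shuffle (word_act ?r r) (act u g (act u (inv\<^bsub>G u\<^esub> g) (act v h ?r1)))"
        using uv by (auto intro!: act_shuffle act_commute simp: insert_commute)
      also have "act u g (act u (inv\<^bsub>G u\<^esub> g) (act v h ?r1)) = act u \<one>\<^bsub>G u\<^esub> (act v \<one>\<^bsub>G v\<^esub> r)"
        using uv r r1 by (simp add: act_mult reduced_word_act)
      also have "shuffle \<dots> (act v \<one>\<^bsub>G v\<^esub> r)" using uv r by (simp add: act_one reduced_word_act)
      also have "shuffle \<dots> r" using uv r by (simp add: act_one)
      finally show "shuffle (word_act ?r r) (word_act [] r)" by simp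
    qed
    moreover obtain a where a: "a \<in> syllable_words V G" "x = cls a" using x cls_surj by blast
    moreover obtain b where b: "b \<in> syllable_words V G" "inv\<^bsub>F\<^esub> x = cls b"
      using cls_surj[of "inv\<^bsub>F\<^esub> x"] x by auto
    ultimately have "act_equiv (a @ ?r @ b) (a @ b)"
      using act_equiv_append[of ?r "[]" b a] by simp
    moreover have "cls [] = cls (a @ b)"
      using a b x F.r_inv[of x] by (simp add: cls_append cls_Nil)
    then have "act_equiv (a @ b) []" using act_equiv_free_product_rel cls_eqD by simp
    ultimately have "act_equiv (a @ ?r @ b) []" by (rule act_equiv_trans)
    moreover have "a @ ?r @ b \<in> syllable_words V G" using a b uv by simp
    moreover have "cls (a @ ?r @ b) = x \<otimes>\<^bsub>F\<^esub> s \<otimes>\<^bsub>F\<^esub> inv\<^bsub>F\<^esub> x"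
      using a b uv s_cls cls_append[of a "?r @ b"] cls_append[of ?r b] F.m_assoc by simp
    ultimately show "\<exists>m. x \<otimes>\<^bsub>F\<^esub> s \<otimes>\<^bsub>F\<^esub> inv\<^bsub>F\<^esub> x = cls m \<and> m \<in> syllable_words V G \<and> act_equiv m []"
      by (intro exI[of _ "a @ ?r @ b"]) simp
  qed
  ultimately have "N \<subseteq> ?K" unfolding normal_closure_def by (intro F.generate_subgroup_incl)
  then show ?thesis using assms that by blast
qed

text \<open>The action descends to the graph product. This makes \<open>fr\<close> below independent
  of the chosen word and shows that vertex groups embed.\<close>

lemma ev_eqD:
  assumes "ev a = ev b" "a \<in> syllable_words V G" "b \<in> syllable_words V G"
  shows "act_equiv a b"
proof -
  have "cls a \<in> N #>\<^bsub>F\<^esub> cls a"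
    using F.rcos_self[of "cls a" N] normal_imp_subgroup[OF N_normal] assms(2) by simp
  then have "cls a \<in> N #>\<^bsub>F\<^esub> cls b" using assms(1) by (simp add: ev_def)
  then obtain n where n: "n \<in> N" "cls a = n \<otimes>\<^bsub>F\<^esub> cls b" by (auto simp: r_coset_def)
  obtain m where m: "m \<in> syllable_words V G" "n = cls m" "act_equiv m []"
    using N_acts_trivially[OF n(1)] by blast
  have "cls (m @ b) = cls a" using n m assms cls_append by simp
  then have "act_equiv a (m @ b)" using cls_eqD m assms act_equiv_free_product_rel by simp
  also have "act_equiv (m @ b) b" using act_equiv_append[OF m(3) assms(3), of "[]"] by simp
  finally show ?thesis .
qed

lemma ev_hom: "(\<lambda>x. N #>\<^bsub>F\<^esub> x) \<in> hom F P"
  unfolding graph_product_def by (rule normal.r_coset_hom_Mod[OF N_normal])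

lemma ev_carrier [simp]: "w \<in> syllable_words V G \<Longrightarrow> ev w \<in> carrier P"
  using hom_in_carrier[OF ev_hom] by (simp add: ev_def)

lemma ev_append:
  "\<lbrakk>a \<in> syllable_words V G; b \<in> syllable_words V G\<rbrakk> \<Longrightarrow> ev (a @ b) = ev a \<otimes>\<^bsub>P\<^esub> ev b"
  using hom_mult[OF ev_hom] by (simp add: ev_def cls_append)

lemma ev_Nil: "ev [] = \<one>\<^bsub>P\<^esub>"
  using hom_one[OF ev_hom F.is_group P.is_group] by (simp add: ev_def cls_Nil)

lemma ev_surj:
  assumes "x \<in> carrier P"
  obtains w where "w \<in> syllable_words V G" "x = ev w"
proof -
  obtain y where "y \<in> carrier F" "x = N #>\<^bsub>F\<^esub> y"
    using assms by (auto simp: graph_product_def FactGroup_def RCOSETS_def)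
  then show ?thesis using cls_surj that unfolding ev_def by metis
qed

section \<open>Vertex groups inside the graph product\<close>

definition syl :: "'v \<Rightarrow> 'a \<Rightarrow> ('v \<times> 'a) list set set" where
  "syl v g = ev [(v, g)]"

lemma syl_carrier [simp]: "\<lbrakk>v \<in> V; g \<in> carrier (G v)\<rbrakk> \<Longrightarrow> syl v g \<in> carrier P"
  by (simp add: syl_def)

lemma syl_hom: "v \<in> V \<Longrightarrow> syl v \<in> hom (G v) P"
  using hom_compose[OF free_product_incl_hom[OF grp] ev_hom, of v]
  unfolding comp_def by (simp add: syl_def[abs_def] ev_def cls_syllable)

lemma syl_mult:
  "\<lbrakk>v \<in> V; g \<in> carrier (G v); h \<in> carrier (G v)\<rbrakk> \<Longrightarrow> syl v (g \<otimes>\<^bsub>G v\<^esub> h) = syl v g \<otimes>\<^bsub>P\<^esub> syl v h"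
  using hom_mult[OF syl_hom] by blast

lemma syl_one: "v \<in> V \<Longrightarrow> syl v \<one>\<^bsub>G v\<^esub> = \<one>\<^bsub>P\<^esub>"
  using hom_one[OF syl_hom G_group P.is_group] by blast

text \<open>Acting on the empty word recovers a syllable as the head of the result.\<close>

lemma syl_inj: "v \<in> V \<Longrightarrow> inj_on (syl v) (carrier (G v))"
proof (rule inj_onI)
  fix g h assume v: "v \<in> V" and gh: "g \<in> carrier (G v)" "h \<in> carrier (G v)" "syl v g = syl v h"
  then have "act_equiv [(v, g)] [(v, h)]" by (intro ev_eqD) (auto simp: syl_def)
  then have "shuffle (act v g []) (act v h [])" by (force simp: act_equiv_def)
  from head_shuffle[OF this, of v] show "g = h" using v gh by (simp add: head_act)
qed

lemma syl_commute:
  assumes "{u, v} \<in> E" "g \<in> carrier (G u)" "h \<in> carrier (G v)"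
  shows "syl u g \<otimes>\<^bsub>P\<^esub> syl v h = syl v h \<otimes>\<^bsub>P\<^esub> syl u g"
proof -
  let ?x = "cls [(u, g)]" and ?y = "cls [(v, h)]"
  let ?q = "\<lambda>x. N #>\<^bsub>F\<^esub> x"
  let ?r = "?x \<otimes>\<^bsub>F\<^esub> ?y \<otimes>\<^bsub>F\<^esub> inv\<^bsub>F\<^esub> ?x \<otimes>\<^bsub>F\<^esub> inv\<^bsub>F\<^esub> ?y"
  have uv: "u \<in> V" "v \<in> V" using edge assms by auto
  have c: "?x \<in> carrier F" "?y \<in> carrier F" using uv assms by auto
  have rel: "?r \<in> graph_product_relators V E G"
    using uv assms by (auto simp: graph_product_relators_def cls_syllable)
  have "?r \<in> N"
    unfolding normal_closure_def
  proof (rule generate.incl)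
    have "?r = \<one>\<^bsub>F\<^esub> \<otimes>\<^bsub>F\<^esub> ?r \<otimes>\<^bsub>F\<^esub> inv\<^bsub>F\<^esub> \<one>\<^bsub>F\<^esub>" using c by simp
    then show "?r \<in> {x \<otimes>\<^bsub>F\<^esub> s \<otimes>\<^bsub>F\<^esub> inv\<^bsub>F\<^esub> x |x s. x \<in> carrier F \<and> s \<in> graph_product_relators V E G}"
      using rel by blast
  qed
  then have "?q ?r = \<one>\<^bsub>P\<^esub>"
    using F.coset_join2[OF _ normal_imp_subgroup[OF N_normal]] c
    by (simp add: graph_product_def FactGroup_def)
  moreover have "inv\<^bsub>F\<^esub> ?y \<otimes>\<^bsub>F\<^esub> (?y \<otimes>\<^bsub>F\<^esub> ?x) = ?x" using c by (simp add: F.m_assoc[symmetric])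
  then have "?x \<otimes>\<^bsub>F\<^esub> ?y = ?r \<otimes>\<^bsub>F\<^esub> (?y \<otimes>\<^bsub>F\<^esub> ?x)" using c by (simp add: F.m_assoc)
  ultimately have "?q (?x \<otimes>\<^bsub>F\<^esub> ?y) = ?q (?y \<otimes>\<^bsub>F\<^esub> ?x)"
    using hom_mult[OF ev_hom, of ?r "?y \<otimes>\<^bsub>F\<^esub> ?x"] hom_in_carrier[OF ev_hom, of "?y \<otimes>\<^bsub>F\<^esub> ?x"] c
    by simp
  then show ?thesis
    using hom_mult[OF ev_hom] c by (simp add: syl_def ev_def)
qed

text \<open>The chosen word turns the empty word into a reduced word for \<open>x\<close>, whose
  head is mapped back into the group. The choice is harmless by \<open>fr_ev\<close>, because
  different words for \<open>x\<close> give shuffled results and \<open>head\<close> is invariant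
  under shuffling.\<close>

definition fr :: "'v \<Rightarrow> ('v \<times> 'a) list set set \<Rightarrow> ('v \<times> 'a) list set set" where
  "fr v x = syl v (head v (word_act (SOME w. w \<in> syllable_words V G \<and> ev w = x) []))"

lemma fr_ev:
  assumes "w \<in> syllable_words V G"
  shows "fr v (ev w) = syl v (head v (word_act w []))"
proof -
  let ?w = "SOME w'. w' \<in> syllable_words V G \<and> ev w' = ev w"
  have w: "?w \<in> syllable_words V G \<and> ev ?w = ev w" by (rule someI[of _ w]) (use assms in simp)
  then have "act_equiv ?w w" using ev_eqD assms by blast
  then have "shuffle (word_act ?w []) (word_act w [])" by (simp add: act_equiv_def)
  then show ?thesis unfolding fr_def by (simp add: head_shuffle)
qed

text \<open>Each axiom on elements is checked on representing words: \<open>head_act\<close>,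
  \<open>head_act_adj\<close> and \<open>head_nonadj\<close> give the three rules for
  fronts.\<close>

sublocale syllable_group P V "\<lambda>u v. {u, v} \<in> E" "\<lambda>v. syl v ` carrier (G v)" fr
proof (intro syllable_group.intro syllable_group_axioms.intro)
  show "group P" by (rule P.is_group)
  have red: "reduced_word (word_act w [])" if "w \<in> syllable_words V G" for w
    using that by (simp add: reduced_word_word_act)
  have cons: "syl v g \<otimes>\<^bsub>P\<^esub> ev w = ev ((v, g) # w)"
    if "v \<in> V" "g \<in> carrier (G v)" "w \<in> syllable_words V G" for v g w
    using ev_append[of "[(v, g)]" w] that by (simp add: syl_def)
  fix u v
  show "{u, v} \<in> E \<Longrightarrow> {v, u} \<in> E" by (simp add: insert_commute)
  show "{v, v} \<notin> E" by simp
  show "v \<in> V \<Longrightarrow> subgroup (syl v ` carrier (G v)) P"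
    using group_hom.img_is_subgroup[OF group_hom.intro[OF G_group P.is_group]] syl_hom
    by (simp add: group_hom_axioms_def)
  show "g \<otimes>\<^bsub>P\<^esub> h = h \<otimes>\<^bsub>P\<^esub> g"
    if "{u, v} \<in> E" "u \<in> V" "v \<in> V" "g \<in> syl u ` carrier (G u)" "h \<in> syl v ` carrier (G v)" for g h
    using that(4,5) by (elim imageE) (simp add: syl_commute[OF that(1)])
  show "fr v x \<in> syl v ` carrier (G v)" if "v \<in> V" "x \<in> carrier P" for x
    using that(2) by (rule ev_surj) (simp add: that(1) fr_ev red imageI)
  show "v \<in> V \<Longrightarrow> fr v \<one>\<^bsub>P\<^esub> = \<one>\<^bsub>P\<^esub>" using fr_ev[of "[]" v] by (simp add: ev_Nil syl_one)
  show "fr v (k \<otimes>\<^bsub>P\<^esub> x) = k \<otimes>\<^bsub>P\<^esub> fr v x"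
    if v: "v \<in> V" and k: "k \<in> syl v ` carrier (G v)" and x: "x \<in> carrier P" for k x
  proof -
    obtain g where g: "g \<in> carrier (G v)" "k = syl v g" using k by blast
    obtain w where w: "w \<in> syllable_words V G" "x = ev w" by (rule ev_surj[OF x])
    show ?thesis using v g w by (simp add: cons fr_ev head_act red syl_mult)
  qed
  show "fr v (k \<otimes>\<^bsub>P\<^esub> x) = fr v x"
    if uv: "{u, v} \<in> E" "u \<in> V" "v \<in> V" and k: "k \<in> syl u ` carrier (G u)" and x: "x \<in> carrier P"
    for k x
  proof -
    obtain g where g: "g \<in> carrier (G u)" "k = syl u g" using k by blast
    obtain w where w: "w \<in> syllable_words V G" "x = ev w" by (rule ev_surj[OF x])
    show ?thesis using uv g w by (simp add: cons fr_ev head_act_adj)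
  qed
  show "fr u x = \<one>\<^bsub>P\<^esub> \<or> fr v x = \<one>\<^bsub>P\<^esub>"
    if "{u, v} \<notin> E" "u \<noteq> v" "u \<in> V" "v \<in> V" "x \<in> carrier P" for x
    using \<open>x \<in> carrier P\<close>
  proof (rule ev_surj)
    fix w assume "w \<in> syllable_words V G" "x = ev w"
    then have "fr r x = syl r (head r (word_act w []))" for r by (simp add: fr_ev)
    then show ?thesis
      using head_nonadj[OF that(2,1), of "word_act w []"] syl_one that(3,4) by metis
  qed
  show "Q x" if x: "x \<in> carrier P" and Q: "Q \<one>\<^bsub>P\<^esub>"
    and step: "\<And>v k y. \<lbrakk>v \<in> V; k \<in> syl v ` carrier (G v); y \<in> carrier P; Q y\<rbrakk> \<Longrightarrow> Q (k \<otimes>\<^bsub>P\<^esub> y)"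
    for x Q
    using x
  proof (rule ev_surj)
    fix w assume "w \<in> syllable_words V G" "x = ev w"
    moreover have "Q (ev w)" if "w \<in> syllable_words V G"
      using that
    proof (induction w)
      case Nil
      then show ?case using Q ev_Nil by simp
    next
      case (Cons p w)
      obtain v g where p: "p = (v, g)" by (cases p)
      have v: "v \<in> V" "g \<in> carrier (G v)" "w \<in> syllable_words V G"
        using Cons.prems by (simp_all add: p)
      have "Q (syl v g \<otimes>\<^bsub>P\<^esub> ev w)"
        by (rule step[OF v(1) imageI[OF v(2)] ev_carrier[OF v(3)] Cons.IH[OF v(3)]])
      then show ?case using cons[OF v] p by simp
    qed
    ultimately show "Q x" by simp
  qed
qed

lemma st_eq_star: "u \<in> V \<Longrightarrow> st u = star V E u"
  by (auto simp: st_def lk_def star_def insert_commute)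

lemma syl_nontrivial:
  assumes "v \<in> V" "\<not> trivial_group (G v)"
  shows "syl v ` carrier (G v) \<noteq> {\<one>\<^bsub>P\<^esub>}"
proof
  assume eq: "syl v ` carrier (G v) = {\<one>\<^bsub>P\<^esub>}"
  have "carrier (G v) = {\<one>\<^bsub>G v\<^esub>}"
  proof (rule antisym)
    show "carrier (G v) \<subseteq> {\<one>\<^bsub>G v\<^esub>}"
    proof
      fix g assume g: "g \<in> carrier (G v)"
      then have "syl v g \<in> {\<one>\<^bsub>P\<^esub>}" unfolding eq[symmetric] by (rule imageI)
      then have "syl v g = syl v \<one>\<^bsub>G v\<^esub>" using syl_one[OF assms(1)] by simp
      then show "g \<in> {\<one>\<^bsub>G v\<^esub>}" using inj_onD[OF syl_inj[OF assms(1)]] g assms(1) by simp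
    qed
  qed (use assms in simp)
  then show False using assms(2) G_group[OF assms(1)] by (simp add: trivial_group_def)
qed

end

theorem theorem1p1:
  fixes V :: "'v set" and E :: "'v set set" and U :: "'v set"
    and \<G> :: "'v \<Rightarrow> ('a, 'b) monoid_scheme"
  assumes "simplicial_graph V E"
    and "finite U" and "U \<subseteq> V" and "coneless V E U"
    and "\<And>v. v \<in> V \<Longrightarrow> group (\<G> v)"
    and "\<And>v. v \<in> V \<Longrightarrow> \<not> trivial_group (\<G> v)"
  shows "(\<forall>\<phi> \<in> hom (graph_product V E \<G>) (graph_product V E \<G>).
            pointwise_inner (graph_product V E \<G>) \<phi> \<longrightarrow>
            inner_automorphism (graph_product V E \<G>) \<phi>)
       \<and> grossman_property_A (graph_product V E \<G>)"
proof -
  interpret graph_of_groups V E \<G>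
    by unfold_locales (use assms in auto)
  have "V \<inter> (\<Inter>u\<in>U. st u) = {}"
  proof -
    have "st u = star V E u" if "u \<in> U" for u using st_eq_star assms(3) that by blast
    then show ?thesis using assms(4) by (simp add: coneless_def)
  qed
  then have "inner_automorphism P \<phi>" if "\<phi> \<in> hom P P" "pointwise_inner P \<phi>" for \<phi>
    by (rule pointwise_inner_imp_inner[OF that assms(2,3)]) (rule syl_nontrivial[OF _ assms(6)])
  \<comment> \<open>Automorphisms are homomorphisms, so property (A) is a special case of the first
    claim.\<close>
  then show ?thesis by (simp add: grossman_property_A_def iso_def)
qed

end
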